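(* Let $g\ge 1$, let $V\subset(\mathbb{P}^1)^g$ be a subvariety defined over $\mathbb{Q}$, and let $\Phi:=(f,\dots,f)$ act on $(\mathbb{P}^1)^g$ coordinatewise, where $f\in\mathbb{Q}[t]$ is a quadratic polynomial. Let $\mathcal{O}$ be the $\Phi$-orbit of a point $(x_1,\dots,x_g)\in(\mathbb{P}^1)^g(\mathbb{Q})$. Then $V(\mathbb{Q})\cap\mathcal{O}$ is a union of at most finitely many orbits of the form $\{\Phi^{nk+\ell}(x_1,\dots,x_g)\}_{n\ge 0}$ for nonnegative integers $k$ and $\ell$.
   Context: $\Phi^m$ denotes the $m$-th iterate of $\Phi$ ($\Phi^0$ is the identity), and the $\Phi$-orbit of $\alpha$ is the forward orbit $\{\Phi^m(\alpha): m\ge 0\}$. The value $k=0$ is allowed, giving singleton orbits. Subvarieties are closed and not necessarily irreducible. *)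

theory Defs
  imports
    Complex_Main
    "HOL-Analysis.Finite_Cartesian_Product"
    "HOL-Computational_Algebra.Polynomial"
    "HOL-Library.Poly_Mapping"
begin

definition proj1_rel :: "'a::field \<times> 'a \<Rightarrow> 'a \<times> 'a \<Rightarrow> bool" where
  "proj1_rel p q \<longleftrightarrow> p \<noteq> (0, 0) \<and> q \<noteq> (0, 0) \<and>
     (\<exists>c. c \<noteq> 0 \<and> fst q = c * fst p \<and> snd q = c * snd p)"

lemma proj1_rel_refl: "p \<noteq> (0, 0) \<Longrightarrow> proj1_rel p p"
  unfolding proj1_rel_def by (auto intro: exI[of _ 1])

lemma proj1_rel_sym: "proj1_rel p q \<Longrightarrow> proj1_rel q p"
proof -
  assume "proj1_rel p q"
  then obtain c where "p \<noteq> (0, 0)" "q \<noteq> (0, 0)" "c \<noteq> 0"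
    "fst q = c * fst p" "snd q = c * snd p"
    unfolding proj1_rel_def by blast
  then show ?thesis
    unfolding proj1_rel_def by (intro conjI exI[of _ "inverse c"]) auto
qed

lemma proj1_rel_trans: "proj1_rel p q \<Longrightarrow> proj1_rel q r \<Longrightarrow> proj1_rel p r"
proof -
  assume "proj1_rel p q" "proj1_rel q r"
  then obtain c d where "p \<noteq> (0, 0)" "r \<noteq> (0, 0)" "c \<noteq> 0" "d \<noteq> 0"
    "fst q = c * fst p" "snd q = c * snd p" "fst r = d * fst q" "snd r = d * snd q"
    unfolding proj1_rel_def by blast
  then show ?thesis
    unfolding proj1_rel_def by (intro conjI exI[of _ "d * c"]) auto
qed

quotient_type (overloaded) 'a proj1 = "'a::field \<times> 'a" / partial: proj1_rel
proof (rule part_equivpI)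
  show "\<exists>p :: 'a \<times> 'a. proj1_rel p p"
    by (rule exI[of _ "(1, 0)"]) (simp add: proj1_rel_refl)
  show "symp (proj1_rel :: 'a \<times> 'a \<Rightarrow> _)"
    by (rule sympI) (rule proj1_rel_sym)
  show "transp (proj1_rel :: 'a \<times> 'a \<Rightarrow> _)"
    by (rule transpI) (rule proj1_rel_trans)
qed

text \<open>\<open>proj1_coords z a b\<close> says \<open>z = [a : b]\<close>; in particular \<open>(a, b) \<noteq> (0, 0)\<close>.
  The affine point \<open>t\<close> is \<open>[t : 1]\<close>, and infinity is \<open>[1 : 0]\<close>.\<close>

lift_definition proj1_coords :: "'a::field proj1 \<Rightarrow> 'a \<Rightarrow> 'a \<Rightarrow> bool"
  is "\<lambda>p a b. proj1_rel p (a, b)"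
  by (intro ext iffI) (blast intro: proj1_rel_sym proj1_rel_trans)+

lift_definition proj1_of_rat :: "rat proj1 \<Rightarrow> 'k::field_char_0 proj1"
  is "\<lambda>(a, b). (of_rat a, of_rat b)"
proof -
  fix p q :: "rat \<times> rat"
  assume "proj1_rel p q"
  then obtain c where "p \<noteq> (0, 0)" "q \<noteq> (0, 0)" "c \<noteq> 0"
    "fst q = c * fst p" "snd q = c * snd p"
    unfolding proj1_rel_def by blast
  then show "proj1_rel (case p of (a, b) \<Rightarrow> (of_rat a :: 'k, of_rat b))
                       (case q of (a, b) \<Rightarrow> (of_rat a, of_rat b))"
    unfolding proj1_rel_def
    by (intro conjI exI[of _ "of_rat c"]) (auto simp: of_rat_mult split: prod.splits)
qed

definition homogenize :: "'a::field poly \<Rightarrow> 'a \<Rightarrow> 'a \<Rightarrow> 'a" where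
  "homogenize f a b = (\<Sum>i\<le>degree f. coeff f i * a ^ i * b ^ (degree f - i))"

lemma homogenize_scale: "homogenize f (c * a) (c * b) = c ^ degree f * homogenize f a b"
  unfolding homogenize_def sum_distrib_left
proof (rule sum.cong[OF refl])
  fix i assume "i \<in> {..degree f}"
  then have "c ^ degree f = c ^ i * c ^ (degree f - i)"
    by (simp flip: power_add)
  then show "coeff f i * (c * a) ^ i * (c * b) ^ (degree f - i) =
      c ^ degree f * (coeff f i * a ^ i * b ^ (degree f - i))"
    by (simp add: power_mult_distrib)
qed

lemma homogenize_at_infinity: "homogenize f a 0 = lead_coeff f * a ^ degree f"
proof -
  have "homogenize f a 0 = (\<Sum>i\<le>degree f. if i = degree f then lead_coeff f * a ^ degree f else 0)"
    unfolding homogenize_def by (rule sum.cong) auto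
  then show ?thesis by simp
qed

text \<open>For \<open>f\<close> of degree \<open>d\<close>, the point \<open>[a : b]\<close> is sent to \<open>[b^d f(a/b) : b^d]\<close>. If
  \<open>d \<ge> 1\<close> this fixes infinity.\<close>

lift_definition proj1_poly :: "'a::field poly \<Rightarrow> 'a proj1 \<Rightarrow> 'a proj1"
  is "\<lambda>f (a, b). (homogenize f a b, b ^ degree f)"
proof -
  fix f :: "'a poly" and p q :: "'a \<times> 'a"
  assume "proj1_rel p q"
  then obtain c where pq: "p \<noteq> (0, 0)" "q \<noteq> (0, 0)" "c \<noteq> 0"
    "fst q = c * fst p" "snd q = c * snd p"
    unfolding proj1_rel_def by blast
  have nz: "(homogenize f a b, b ^ degree f) \<noteq> (0, 0)" if "(a, b) \<noteq> (0, 0)" for a b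
    using that by (cases "b = 0") (auto simp: homogenize_at_infinity)
  obtain a b where p: "p = (a, b)" by (cases p)
  have q: "q = (c * a, c * b)" using pq p by (cases q) simp
  have "proj1_rel (homogenize f a b, b ^ degree f)
                  (homogenize f (c * a) (c * b), (c * b) ^ degree f)"
    unfolding proj1_rel_def
  proof (intro conjI exI[of _ "c ^ degree f"])
    show "(homogenize f a b, b ^ degree f) \<noteq> (0, 0)"
      using nz pq(1) p by blast
    show "(homogenize f (c * a) (c * b), (c * b) ^ degree f) \<noteq> (0, 0)"
      using nz pq(2) q by blast
  qed (use pq(3) in \<open>simp_all add: homogenize_scale power_mult_distrib\<close>)
  then show "proj1_rel (case p of (a, b) \<Rightarrow> (homogenize f a b, b ^ degree f))
                       (case q of (a, b) \<Rightarrow> (homogenize f a b, b ^ degree f))"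
    by (simp add: p q)
qed

definition diag_action :: "'a::field poly \<Rightarrow> 'a proj1 ^ 'n \<Rightarrow> 'a proj1 ^ 'n" where
  "diag_action f x = (\<chi> i. proj1_poly f (x $ i))"

text \<open>A polynomial in indeterminates \<open>'v\<close> is a finitely supported map from monomials to
  coefficients. For \<open>(P^1)^g\<close> with \<open>g = CARD('n)\<close> the indeterminates are
  \<open>Inl i\<close> and \<open>Inr i\<close>, the two homogeneous coordinates of the \<open>i\<close>-th factor.\<close>

type_synonym 'v rat_mpoly = "('v \<Rightarrow>\<^sub>0 nat) \<Rightarrow>\<^sub>0 rat"

definition eval_rat_mpoly :: "'v rat_mpoly \<Rightarrow> ('v \<Rightarrow> 'k::field_char_0) \<Rightarrow> 'k" where
  "eval_rat_mpoly p a =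
     (\<Sum>m\<in>Poly_Mapping.keys p.
        of_rat (Poly_Mapping.lookup p m) *
        (\<Prod>v\<in>Poly_Mapping.keys m. a v ^ Poly_Mapping.lookup m v))"

definition multihomogeneous :: "('n + 'n) rat_mpoly \<Rightarrow> bool" where
  "multihomogeneous p \<longleftrightarrow>
     (\<exists>d. \<forall>m\<in>Poly_Mapping.keys p. \<forall>i.
        Poly_Mapping.lookup m (Inl i) + Poly_Mapping.lookup m (Inr i) = d i)"

definition vanishes_at :: "('n + 'n) rat_mpoly \<Rightarrow> 'k::field_char_0 proj1 ^ 'n \<Rightarrow> bool" where
  "vanishes_at p z \<longleftrightarrow>
     (\<forall>a b. (\<forall>i. proj1_coords (z $ i) (a i) (b i)) \<longrightarrow> eval_rat_mpoly p (case_sum a b) = 0)"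

text \<open>A closed subvariety, not necessarily irreducible, is identified with its set of
  complex points; it is defined over the rationals if it is the common zero locus of
  multihomogeneous polynomials with rational coefficients.\<close>

definition subvariety_over_rat :: "(complex proj1 ^ 'n) set \<Rightarrow> bool" where
  "subvariety_over_rat V \<longleftrightarrow>
     (\<exists>S. (\<forall>p\<in>S. multihomogeneous p) \<and> V = {z. \<forall>p\<in>S. vanishes_at p z})"

definition rational_points :: "(complex proj1 ^ 'n) set \<Rightarrow> (rat proj1 ^ 'n) set" where
  "rational_points V = {x. (\<chi> i. proj1_of_rat (x $ i)) \<in> V}"

definition forward_orbit :: "('x \<Rightarrow> 'x) \<Rightarrow> 'x \<Rightarrow> 'x set" where
  "forward_orbit F x = {(F ^^ m) x | m. True}"

end

theory Submission
  imports Defs "HOL-Number_Theory.Cong"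
begin

text \<open>A quadratic polynomial is conjugate over the rationals to \<open>q t = t\<^sup>2 + c\<close>, so along the orbit
  every affine coordinate is an affine function of an orbit of \<open>q\<close>, and infinity stays put. The
  question is when a polynomial expression in several orbits of \<open>q\<close> is zero, and the answer is
  of Skolem--Mahler--Lech type: after splitting the time axis into residue classes modulo some
  \<open>M\<close>, the expression is, late enough, either zero all the time or only finitely often.

  The reason is \<open>p\<close>-adic interpolation. Suppose that \<open>p\<close> is an odd prime, that \<open>c\<close> and the starting
  points are \<open>p\<close>-integral, and that the orbits avoid the critical point \<open>0\<close> modulo \<open>p\<close> from some
  time on. Modulo powers of \<open>p\<close> the orbits and their derivatives are eventually periodic; for a
  common period \<open>M\<close> the map \<open>q\<^sup>M\<close>, rescaled to the residue disc \<open>u + p y\<close>, is the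
  identity plus \<open>p\<close> times an integral polynomial (\<open>rapid_diffs_of_return\<close>). Iterating such a
  map gives a sequence whose \<open>k\<close>-th differences are divisible by \<open>p\<^sup>k\<close>. Up to powers of \<open>p\<close>
  these sequences form a ring, so every polynomial equation for the variety yields another one,
  and a nonzero sequence of this kind has finitely many zeros
  (\<open>diffs_divisible_infinitely_many_zeros\<close>, an analogue of Strassman's theorem). All of this can be
  said with divisibility of rational numbers; the completion never has to be formed.

  It remains to find \<open>p\<close> (\<open>ex_good_prime\<close>). An orbit that meets \<open>0\<close> twice modulo \<open>p\<close> makes \<open>0\<close>
  periodic modulo \<open>p\<close>, so for \<open>c\<close> other than \<open>0\<close> and \<open>-1\<close> infinitely many primes are wanted
  modulo which \<open>0\<close> is not periodic. Let \<open>x k\<close> be the \<open>k\<close>-th iterate of \<open>0\<close>. An odd prime dividing the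
  numerator of \<open>(x k + x (Suc k)) / c\<close> for some \<open>k > 0\<close> does it: modulo such a prime
  \<open>x k\<close> and \<open>x (Suc k)\<close> are opposite and not zero, hence distinct with the same image, so that \<open>0\<close>
  is strictly preperiodic. Each odd prime divides at most one of these numerators, the numerators are
  not divisible by \<open>4\<close> (for \<open>k > 1\<close>), and they do not stay bounded by \<open>2\<close>; so either one of them is zero, and then every
  large prime is suitable, or infinitely many primes occur
  (\<open>infinitely_many_antifix_primes\<close>). For \<open>c = 0\<close> and \<open>c = -1\<close> the critical point is periodic over the
  rationals, but then the only orbits that run into its cycle modulo a well chosen \<open>p\<close> already do so
  over the rationals, where they become constant or of period two.\<close>

section \<open>The localization of the rationals at an odd prime\<close>

text \<open>The ideal generated by \<open>p\<^sup>e\<close> in the localization of the integers at \<open>p\<close>, as a set of rationals; for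
  \<open>e = 0\<close> it is the ring of \<open>p\<close>-integral rationals, whose units are the elements outside \<open>pideal p 1\<close>.\<close>

definition pideal :: "int \<Rightarrow> nat \<Rightarrow> rat set" where
  "pideal p e = {of_int (p ^ e * a) / of_int b | a b. \<not> p dvd b}"

lemma pidealI: "\<not> p dvd b \<Longrightarrow> r * of_int b = of_int (p ^ e * a) \<Longrightarrow> r \<in> pideal p e"
proof -
  assume b: "\<not> p dvd b" and r: "r * of_int b = of_int (p ^ e * a)"
  then have "b \<noteq> 0" by auto
  with r have "r = of_int (p ^ e * a) / of_int b" by (simp add: field_simps)
  with b show ?thesis unfolding pideal_def by blast
qed

lemma pidealE:
  assumes "r \<in> pideal p e"
  obtains a b where "\<not> p dvd b" "b \<noteq> 0" "r * of_int b = of_int (p ^ e * a)"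
proof -
  obtain a b where ab: "\<not> p dvd b" "r = of_int (p ^ e * a) / of_int b"
    using assms unfolding pideal_def by blast
  then have "b \<noteq> 0" by auto
  then show ?thesis using ab that[of b a] by simp
qed

lemma quotient_denom:
  fixes r :: rat
  obtains a b where "b > 0" "r = of_int a / of_int b"
proof (cases "quotient_of r")
  case (Pair a b)
  then show thesis
    using that quotient_of_denom_pos quotient_of_div by blast
qed

locale odd_prime =
  fixes p :: int
  assumes prime_p: "prime p" and p_gt_2: "p > 2"
begin

lemma pideal_of_int: "p ^ e dvd a \<Longrightarrow> of_int a \<in> pideal p e"
  by (rule pidealI[of p 1 _ e "a div p ^ e"])
     (use p_gt_2 zdvd_imp_le[of p 1] in auto)

lemma of_int_in_pideal_iff: "of_int a \<in> pideal p e \<longleftrightarrow> p ^ e dvd a"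
proof
  assume "of_int a \<in> pideal p e"
  then obtain c b where *: "\<not> p dvd b" "of_int a * of_int b = (of_int (p ^ e * c) :: rat)"
    by (elim pidealE) blast
  then have "a * b = p ^ e * c"
    by (simp flip: of_int_mult)
  then have "p ^ e dvd a * b" by simp
  moreover have "coprime (p ^ e) b"
    using * prime_p by (simp add: prime_imp_coprime)
  ultimately show "p ^ e dvd a"
    by (simp add: coprime_dvd_mult_left_iff)
qed (rule pideal_of_int)

lemma pideal_0 [simp]: "0 \<in> pideal p e"
  using pideal_of_int[of e 0] by simp

lemma pideal_1 [simp]: "1 \<in> pideal p 0"
  using pideal_of_int[of 0 1] by simp

lemma pideal_of_nat [simp]: "of_nat n \<in> pideal p 0"
  using pideal_of_int[of 0 "int n"] by simp

lemma pideal_of_int_0 [simp]: "of_int n \<in> pideal p 0"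
  using pideal_of_int[of 0 n] by simp

lemma pideal_add:
  assumes "r \<in> pideal p e" "s \<in> pideal p e"
  shows "r + s \<in> pideal p e"
proof -
  obtain a b where 1: "\<not> p dvd b" "r * of_int b = of_int (p ^ e * a)"
    using assms(1) by (elim pidealE) blast
  obtain c d where 2: "\<not> p dvd d" "s * of_int d = of_int (p ^ e * c)"
    using assms(2) by (elim pidealE) blast
  have "(r + s) * of_int (b * d) = (r * of_int b) * of_int d + (s * of_int d) * of_int b"
    by (simp add: algebra_simps)
  also have "\<dots> = of_int (p ^ e * (a * d + c * b))"
    unfolding 1 2 by (simp add: algebra_simps)
  finally show ?thesis
    using 1 2 prime_p
    by (intro pidealI[of p "b * d" _ e "a * d + c * b"]) (auto simp: prime_dvd_mult_iff)
qed

lemma pideal_mult: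
  assumes "r \<in> pideal p e" "s \<in> pideal p f"
  shows "r * s \<in> pideal p (e + f)"
proof -
  obtain a b where 1: "\<not> p dvd b" "r * of_int b = of_int (p ^ e * a)"
    using assms(1) by (elim pidealE) blast
  obtain c d where 2: "\<not> p dvd d" "s * of_int d = of_int (p ^ f * c)"
    using assms(2) by (elim pidealE) blast
  have "(r * s) * of_int (b * d) = (r * of_int b) * (s * of_int d)"
    by (simp add: algebra_simps)
  also have "\<dots> = of_int (p ^ (e + f) * (a * c))"
    unfolding 1 2 by (simp add: algebra_simps power_add)
  finally show ?thesis
    using 1 2 prime_p
    by (intro pidealI[of p "b * d" _ "e + f" "a * c"]) (auto simp: prime_dvd_mult_iff)
qed

lemma pideal_mult0:
  "r \<in> pideal p 0 \<Longrightarrow> s \<in> pideal p e \<Longrightarrow> r * s \<in> pideal p e"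
  "r \<in> pideal p e \<Longrightarrow> s \<in> pideal p 0 \<Longrightarrow> r * s \<in> pideal p e"
  using pideal_mult[of r 0 s e] pideal_mult[of r e s 0] by auto

lemma pideal_uminus: "r \<in> pideal p e \<Longrightarrow> - r \<in> pideal p e"
  using pideal_mult0(1)[of "-1" r e] pideal_of_int_0[of "-1"] by simp

lemma pideal_diff: "r \<in> pideal p e \<Longrightarrow> s \<in> pideal p e \<Longrightarrow> r - s \<in> pideal p e"
  using pideal_add[of r e "- s"] pideal_uminus[of s e] by simp

lemma pideal_sum: "(\<And>i. i \<in> A \<Longrightarrow> f i \<in> pideal p e) \<Longrightarrow> sum f A \<in> pideal p e"
  by (induction A rule: infinite_finite_induct) (auto intro: pideal_add)

lemma pideal_power: "r \<in> pideal p 0 \<Longrightarrow> r ^ n \<in> pideal p 0"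
  by (induction n) (auto intro: pideal_mult0)

lemma pideal_mono: "f \<le> e \<Longrightarrow> r \<in> pideal p e \<Longrightarrow> r \<in> pideal p f"
proof (elim pidealE)
  fix a b :: int
  assume "f \<le> e" and *: "\<not> p dvd b" "r * of_int b = of_int (p ^ e * a)"
  then have "p ^ e * a = p ^ f * (p ^ (e - f) * a)"
    by (simp flip: power_add)
  with * show ?thesis by (intro pidealI[of p b r f "p ^ (e - f) * a"]) simp_all
qed

lemma p_power_mult_pideal_iff:
  "of_int (p ^ d) * r \<in> pideal p (d + e) \<longleftrightarrow> r \<in> pideal p e"
proof
  assume "of_int (p ^ d) * r \<in> pideal p (d + e)"
  then obtain a b where *: "\<not> p dvd b" "of_int (p ^ d) * r * of_int b = of_int (p ^ (d + e) * a)"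
    by (elim pidealE) blast
  have "of_int (p ^ d) * (r * of_int b) = of_int (p ^ d) * of_int (p ^ e * a)"
    using *(2) by (simp add: power_add algebra_simps)
  then have "r * of_int b = of_int (p ^ e * a)"
    using p_gt_2 by simp
  with * show "r \<in> pideal p e" by (intro pidealI)
next
  assume "r \<in> pideal p e"
  then show "of_int (p ^ d) * r \<in> pideal p (d + e)"
    by (intro pideal_mult pideal_of_int) auto
qed

text \<open>Here \<open>r\<close> is a unit of the localization, so it can be cancelled from a divisibility.\<close>

lemma pideal_cancel_unit:
  assumes "r \<in> pideal p 0" "r \<notin> pideal p 1" "r * s \<in> pideal p e"
  shows "s \<in> pideal p e"
proof -
  obtain a b where 1: "\<not> p dvd b" "b \<noteq> 0" "r * of_int b = of_int (p ^ 0 * a)"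
    using assms(1) by (elim pidealE) blast
  have "\<not> p dvd a"
  proof
    assume "p dvd a"
    then obtain k where "a = p * k" by blast
    then have "r \<in> pideal p 1"
      using 1 by (intro pidealI[of p b r 1 k]) auto
    then show False using assms(2) by simp
  qed
  obtain c d where 2: "\<not> p dvd d" "(r * s) * of_int d = of_int (p ^ e * c)"
    using assms(3) by (elim pidealE) blast
  have "s * of_int (a * d) = s * of_int d * (r * of_int b)"
    unfolding 1 by simp
  also have "\<dots> = (r * s * of_int d) * of_int b"
    by (simp add: algebra_simps)
  also have "\<dots> = of_int (p ^ e * (c * b))"
    unfolding 2 by simp
  finally have "s * of_int (a * d) = of_int (p ^ e * (c * b))" .
  with \<open>\<not> p dvd a\<close> 2 prime_p show ?thesis
    by (intro pidealI[of p "a * d" _ e "c * b"]) (auto simp: prime_dvd_mult_iff)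
qed

lemma pideal_mult_unit:
  assumes "r \<in> pideal p 0" "r \<notin> pideal p 1" "s \<in> pideal p 0" "s \<notin> pideal p 1"
  shows "r * s \<notin> pideal p 1"
  using pideal_cancel_unit assms by blast

lemma pideal_all_imp_zero:
  assumes "\<And>e. r \<in> pideal p e"
  shows "r = 0"
proof -
  obtain a b where ab: "b > 0" "r = of_int a / of_int b"
    by (rule quotient_denom)
  have "of_int a \<in> pideal p e" for e
    using pideal_mult0(2)[OF assms pideal_of_int_0[of b], of e] ab by simp
  then have dvd: "p ^ e dvd a" for e
    by (simp add: of_int_in_pideal_iff)
  have "a = 0"
  proof (rule ccontr)
    assume "a \<noteq> 0"
    then have "p ^ nat \<bar>a\<bar> \<le> \<bar>a\<bar>"
      using dvd_imp_le_int[OF _ dvd[of "nat \<bar>a\<bar>"]] p_gt_2 by simp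
    moreover have "int (nat \<bar>a\<bar>) < 2 ^ nat \<bar>a\<bar>"
      using of_nat_less_two_power[of "nat \<bar>a\<bar>", where 'a = int] by simp
    moreover have "(2::int) ^ nat \<bar>a\<bar> \<le> p ^ nat \<bar>a\<bar>"
      using p_gt_2 by (intro power_mono) auto
    ultimately show False by simp
  qed
  then show ?thesis using ab by simp
qed

text \<open>The residue ring modulo \<open>p\<^sup>e\<close> is the same as that of the integers, because a denominator prime to
  \<open>p\<close> is invertible modulo \<open>p\<^sup>e\<close>. This is the source of all finiteness in the pigeonhole arguments.\<close>

lemma pideal_residue:
  assumes "r \<in> pideal p 0"
  shows "\<exists>a\<in>{0..<p ^ e}. r - of_int a \<in> pideal p e"
proof -
  obtain a b where 1: "\<not> p dvd b" "b \<noteq> 0" "r * of_int b = of_int (p ^ 0 * a)"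
    using assms(1) by (elim pidealE) blast
  have "coprime b (p ^ e)"
    using 1 prime_p prime_imp_coprime[of p b] by (auto simp: coprime_commute)
  then obtain x where x: "[b * x = 1] (mod p ^ e)"
    using coprime_iff_invertible_int by blast
  define c where "c = (a * x) mod p ^ e"
  have "[c * b = a * (b * x)] (mod p ^ e)"
    unfolding c_def cong_def by (simp add: mod_simps algebra_simps)
  also have "[a * (b * x) = a * 1] (mod p ^ e)"
    by (rule cong_scalar_left[OF x])
  finally have "p ^ e dvd a - c * b"
    by (simp add: cong_iff_dvd_diff dvd_diff_commute)
  then obtain k where "a - c * b = p ^ e * k" by blast
  then have "(r - of_int c) * of_int b = of_int (p ^ e * k)"
    using 1 by (metis left_diff_distrib mult_1 of_int_diff of_int_mult power_0)
  then show ?thesis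
    using 1 p_gt_2 by (intro bexI[of _ c] pidealI[of p b]) (auto simp: c_def)
qed

end

section \<open>Sequences with rapidly divisible differences\<close>

definition fdiff :: "(nat \<Rightarrow> rat) \<Rightarrow> nat \<Rightarrow> rat" where
  "fdiff s n = s (Suc n) - s n"

text \<open>For all \<open>k \<le> K\<close>, the \<open>k\<close>-th differences of \<open>s\<close> are divisible by \<open>p\<^bsup>e + k\<^esup>\<close>. The bound \<open>K\<close> lets
  closure properties be proved by induction, and \<open>e\<close> is what a product of two such sequences adds up.\<close>

primrec diffs_divisible :: "int \<Rightarrow> nat \<Rightarrow> nat \<Rightarrow> (nat \<Rightarrow> rat) \<Rightarrow> bool" where
  "diffs_divisible p 0 e s \<longleftrightarrow> (\<forall>n. s n \<in> pideal p e)"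
| "diffs_divisible p (Suc K) e s \<longleftrightarrow>
     (\<forall>n. s n \<in> pideal p e) \<and> diffs_divisible p K (Suc e) (fdiff s)"

text \<open>The sequences that have a \<open>p\<close>-adically analytic interpolation of the kind needed here. The factor \<open>p\<^sup>d\<close>
  makes room for arbitrary rational constants.\<close>

definition rapid_diffs :: "int \<Rightarrow> (nat \<Rightarrow> rat) \<Rightarrow> bool" where
  "rapid_diffs p s \<longleftrightarrow> (\<exists>d. \<forall>K. diffs_divisible p K 0 (\<lambda>n. of_int (p ^ d) * s n))"

text \<open>Polynomial functions with \<open>p\<close>-integral coefficients, generated by closure rather than given by
  coefficients, since closure under composition with sequences is all that is asked of them.\<close>

inductive_set integral_polyfun :: "int \<Rightarrow> (rat \<Rightarrow> rat) set" for p where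
  const: "c \<in> pideal p 0 \<Longrightarrow> (\<lambda>_. c) \<in> integral_polyfun p"
| ident: "(\<lambda>y. y) \<in> integral_polyfun p"
| add: "F \<in> integral_polyfun p \<Longrightarrow> G \<in> integral_polyfun p \<Longrightarrow> (\<lambda>y. F y + G y) \<in> integral_polyfun p"
| mult: "F \<in> integral_polyfun p \<Longrightarrow> G \<in> integral_polyfun p \<Longrightarrow> (\<lambda>y. F y * G y) \<in> integral_polyfun p"

lemma newton_forward:
  "s n = (\<Sum>k\<le>n. of_nat (n choose k) * (fdiff ^^ k) s 0)"
proof (induction n arbitrary: s)
  case (Suc n)
  let ?D = "\<lambda>k. (fdiff ^^ k) s 0"
  have "s (Suc n) = s n + fdiff s n"
    by (simp add: fdiff_def)
  also have "\<dots> = (\<Sum>k\<le>n. of_nat (n choose k) * ?D k) + (\<Sum>k\<le>n. of_nat (n choose k) * ?D (Suc k))"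
    using Suc[of s] Suc[of "fdiff s"] by (simp add: funpow_swap1)
  also have "(\<Sum>k\<le>n. of_nat (n choose k) * ?D k) = (\<Sum>k\<le>Suc n. of_nat (n choose k) * ?D k)"
    by (simp add: binomial_eq_0)
  also have "\<dots> = ?D 0 + (\<Sum>k\<le>n. of_nat (n choose Suc k) * ?D (Suc k))"
    by (simp only: sum.atMost_Suc_shift) simp
  also have "\<dots> + (\<Sum>k\<le>n. of_nat (n choose k) * ?D (Suc k)) =
      ?D 0 + (\<Sum>k\<le>n. of_nat (Suc n choose Suc k) * ?D (Suc k))"
    by (simp add: algebra_simps sum.distrib)
  also have "\<dots> = (\<Sum>k\<le>Suc n. of_nat (Suc n choose k) * ?D k)"
    by (simp only: sum.atMost_Suc_shift) simp
  finally show ?case .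
qed simp

definition falling_poly :: "nat \<Rightarrow> rat poly" where
  "falling_poly k = (\<Prod>j<k. [:- of_nat j, 1:])"

lemma poly_falling_poly: "poly (falling_poly k) (of_nat n) = of_nat (n choose k) * fact k"
  by (simp add: falling_poly_def poly_prod binomial_gbinomial gbinomial_prod_rev atLeast0LessThan)

lemma coeff_falling_poly_beyond: "i > k \<Longrightarrow> coeff (falling_poly k) i = 0"
proof (induction k arbitrary: i)
  case 0
  then show ?case by (cases i) (auto simp: falling_poly_def)
next
  case (Suc k)
  then obtain j where "i = Suc j" by (cases i) auto
  with Suc show ?case by (simp add: falling_poly_def)
qed

context odd_prime begin

lemma diffs_divisible_D: "diffs_divisible p K e s \<Longrightarrow> s n \<in> pideal p e"
  by (cases K) auto

lemma diffs_divisible_Suc_D: "diffs_divisible p (Suc K) e s \<Longrightarrow> diffs_divisible p K e s"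
  by (induction K arbitrary: e s) auto

lemma diffs_divisible_shift: "diffs_divisible p K e s \<Longrightarrow> diffs_divisible p K e (\<lambda>n. s (Suc n))"
proof (induction K arbitrary: e s)
  case (Suc K)
  have "fdiff (\<lambda>n. s (Suc n)) = (\<lambda>n. fdiff s (Suc n))"
    by (simp add: fdiff_def fun_eq_iff)
  with Suc show ?case by auto
qed simp

lemma diffs_divisible_add:
  "diffs_divisible p K e s \<Longrightarrow> diffs_divisible p K e t \<Longrightarrow> diffs_divisible p K e (\<lambda>n. s n + t n)"
proof (induction K arbitrary: e s t)
  case (Suc K)
  have "fdiff (\<lambda>n. s n + t n) = (\<lambda>n. fdiff s n + fdiff t n)"
    by (simp add: fdiff_def fun_eq_iff)
  with Suc show ?case by (auto intro: pideal_add)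
qed (auto intro: pideal_add)

lemma diffs_divisible_mult:
  "diffs_divisible p K e s \<Longrightarrow> diffs_divisible p K f t \<Longrightarrow>
    diffs_divisible p K (e + f) (\<lambda>n. s n * t n)"
proof (induction K arbitrary: e f s t)
  case (Suc K)
  have "fdiff (\<lambda>n. s n * t n) = (\<lambda>n. s (Suc n) * fdiff t n + fdiff s n * t n)"
    by (simp add: fdiff_def fun_eq_iff algebra_simps)
  moreover have "diffs_divisible p K (e + Suc f) (\<lambda>n. s (Suc n) * fdiff t n)"
    by (rule Suc.IH[OF diffs_divisible_shift[OF diffs_divisible_Suc_D[OF Suc.prems(1)]]])
       (use Suc.prems(2) in simp)
  moreover have "diffs_divisible p K (Suc e + f) (\<lambda>n. fdiff s n * t n)"
    by (rule Suc.IH[OF _ diffs_divisible_Suc_D[OF Suc.prems(2)]]) (use Suc.prems(1) in simp)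
  ultimately have "diffs_divisible p K (Suc (e + f)) (fdiff (\<lambda>n. s n * t n))"
    using diffs_divisible_add[of K "Suc (e + f)" "\<lambda>n. s (Suc n) * fdiff t n"] by simp
  with Suc.prems show ?case by (auto intro: pideal_mult)
qed (auto intro: pideal_mult)

lemma diffs_divisible_zero: "diffs_divisible p K e (\<lambda>_. 0)"
proof (induction K arbitrary: e)
  case (Suc K)
  have "fdiff (\<lambda>_. 0) = (\<lambda>_. 0)"
    by (simp add: fdiff_def fun_eq_iff)
  with Suc show ?case by auto
qed auto

lemma diffs_divisible_const: "c \<in> pideal p e \<Longrightarrow> diffs_divisible p K e (\<lambda>_. c)"
proof (cases K)
  case (Suc k)
  have "fdiff (\<lambda>_. c) = (\<lambda>_. 0)"
    by (simp add: fdiff_def fun_eq_iff)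
  then show "c \<in> pideal p e \<Longrightarrow> ?thesis"
    using diffs_divisible_zero by (simp add: Suc)
qed auto

lemma iterated_diff_in_pideal:
  "diffs_divisible p K e s \<Longrightarrow> k \<le> K \<Longrightarrow> (fdiff ^^ k) s n \<in> pideal p (e + k)"
proof (induction K arbitrary: k e s)
  case (Suc K)
  then show ?case
  proof (cases k)
    case (Suc j)
    then have "(fdiff ^^ j) (fdiff s) n \<in> pideal p (Suc e + j)"
      using Suc.prems Suc.IH[of "Suc e" "fdiff s" j] by simp
    then show ?thesis by (simp add: Suc funpow_swap1)
  qed auto
qed auto

lemma integral_polyfun_pideal:
  "F \<in> integral_polyfun p \<Longrightarrow> y \<in> pideal p 0 \<Longrightarrow> F y \<in> pideal p 0"
  by (induction rule: integral_polyfun.induct) (auto intro: pideal_add pideal_mult0)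

lemma integral_polyfun_diffs_divisible:
  "F \<in> integral_polyfun p \<Longrightarrow> diffs_divisible p K 0 s \<Longrightarrow> diffs_divisible p K 0 (\<lambda>n. F (s n))"
proof (induction rule: integral_polyfun.induct)
  case (const c)
  then show ?case by (simp add: diffs_divisible_const)
next
  case (add F G)
  then show ?case by (simp add: diffs_divisible_add)
next
  case (mult F G)
  then show ?case
    using diffs_divisible_mult[of K 0 "\<lambda>n. F (s n)" 0 "\<lambda>n. G (s n)"] by simp
qed

text \<open>The difference of \<open>t\<close> is \<open>p\<close> times an integral polynomial in \<open>t\<close>, so each bound for the differences
  of \<open>t\<close> up to order \<open>K\<close> gains one more factor \<open>p\<close> and one more order.\<close>

lemma near_identity_iteration_diffs_divisible:
  assumes G: "G \<in> integral_polyfun p" and t0: "t 0 \<in> pideal p 0"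
    and step: "\<And>n. t (Suc n) = t n + of_int p * G (t n)"
  shows "diffs_divisible p K 0 t"
proof (induction K)
  case 0
  have "t n \<in> pideal p 0" for n
  proof (induction n)
    case (Suc n)
    show ?case
      unfolding step
      by (rule pideal_add[OF Suc pideal_mult0(1)[OF pideal_of_int_0 integral_polyfun_pideal[OF G Suc]]])
  qed (rule t0)
  then show ?case by simp
next
  case (Suc K)
  have "diffs_divisible p K (1 + 0) (\<lambda>n. of_int p * G (t n))"
    by (rule diffs_divisible_mult[OF diffs_divisible_const
          integral_polyfun_diffs_divisible[OF G Suc]]) (simp add: pideal_of_int)
  moreover have "fdiff t = (\<lambda>n. of_int p * G (t n))"
    by (simp add: fdiff_def step fun_eq_iff)
  ultimately show ?case using Suc by (auto dest: diffs_divisible_D)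
qed

lemma coeff_falling_poly_in_pideal: "coeff (falling_poly k) i \<in> pideal p 0"
proof (induction k arbitrary: i)
  case 0
  then show ?case by (simp add: falling_poly_def coeff_1)
next
  case (Suc k)
  have "falling_poly (Suc k) = [:- of_nat k, 1:] * falling_poly k"
    by (simp add: falling_poly_def mult.commute)
  then show ?case
    using Suc[of i] Suc[of "i - 1"]
    by (cases i) (auto simp: coeff_pCons intro!: pideal_diff pideal_uminus pideal_mult0)
qed

text \<open>One step of Legendre's formula: the multiples of \<open>p\<close> among the factors contribute one \<open>p\<close> each, and
  what is left of them is again a factorial.\<close>

lemma fact_p_part: "\<exists>m. fact n = p ^ (n div nat p) * fact (n div nat p) * m \<and> \<not> p dvd m"
proof (induction n)
  case 0
  then show ?case using p_gt_2 by (intro exI[of _ 1]) (auto dest: zdvd_imp_le)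
next
  case (Suc n)
  then obtain m where m: "fact n = p ^ (n div nat p) * fact (n div nat p) * m" "\<not> p dvd m"
    by blast
  have np: "int (nat p) = p" using p_gt_2 by simp
  show ?case
  proof (cases "Suc n mod nat p = 0")
    case True
    then have d: "Suc n div nat p = Suc (n div nat p)"
      by (simp add: div_Suc)
    have "Suc n = nat p * Suc (n div nat p)"
      using True d by (metis mult_div_mod_eq add_0_right)
    then have "int (Suc n) = int (nat p) * int (Suc (n div nat p))"
      by (metis of_nat_mult)
    then have "int (Suc n) = p * int (Suc (n div nat p))"
      by (simp only: np)
    then have "fact (Suc n) = p * int (Suc (n div nat p)) * fact n"
      by (simp only: fact_Suc of_nat_id)
    then show ?thesis
      using m d by (intro exI[of _ m]) (simp add: algebra_simps)
  next
    case False
    then have d: "Suc n div nat p = n div nat p"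
      by (simp add: div_Suc)
    have "\<not> p dvd int (Suc n)"
      using False int_dvd_int_iff[of "nat p" "Suc n"] by (metis np dvd_eq_mod_eq_0)
    then have "\<not> p dvd m * int (Suc n)"
      using m prime_p by (simp add: prime_dvd_mult_iff del: of_nat_Suc)
    moreover have "fact (Suc n) = fact n * int (Suc n)"
      by (simp add: algebra_simps)
    ultimately show ?thesis
      using m d by (intro exI[of _ "m * int (Suc n)"]) (simp add: algebra_simps)
  qed
qed

text \<open>The bound \<open>2 * v \<le> n\<close> is where \<open>p > 2\<close> matters: the valuation of \<open>fact n\<close> is at most
  \<open>n / (p - 1)\<close>, so that in a Newton series the factors \<open>p\<^sup>k\<close> outgrow the denominators \<open>fact k\<close>.\<close>

lemma fact_valuation: "\<exists>v m. fact n = p ^ v * m \<and> \<not> p dvd m \<and> 2 * v \<le> n"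
proof (induction n rule: less_induct)
  case (less n)
  define q where "q = n div nat p"
  show ?case
  proof (cases "n = 0")
    case True
    then show ?thesis using p_gt_2 by (intro exI[of _ 0] exI[of _ 1]) (auto dest: zdvd_imp_le)
  next
    case False
    then have "q < n" using p_gt_2 by (simp add: q_def)
    then obtain v m where vm: "fact q = p ^ v * m" "\<not> p dvd m" "2 * v \<le> q"
      using less by blast
    obtain l where l: "fact n = p ^ q * fact q * l" "\<not> p dvd l"
      using fact_p_part[of n] q_def by blast
    have "q * 3 \<le> q * nat p"
      using p_gt_2 by (intro mult_left_mono) auto
    also have "\<dots> \<le> n" by (simp add: q_def)
    finally have "2 * (q + v) \<le> n" using vm by simp
    moreover have "fact n = p ^ (q + v) * (m * l)"
      using l vm by (simp add: power_add algebra_simps)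
    moreover have "\<not> p dvd m * l"
      using l vm prime_p by (simp add: prime_dvd_mult_iff)
    ultimately show ?thesis by blast
  qed
qed

lemma div_fact_in_pideal:
  assumes "c \<in> pideal p k"
  shows "c / fact k \<in> pideal p (k div 2)"
proof -
  obtain v m where vm: "fact k = p ^ v * m" "\<not> p dvd m" "2 * v \<le> k"
    using fact_valuation by blast
  have f: "(fact k :: rat) = of_int (p ^ v) * of_int m"
    by (metis of_int_fact of_int_mult vm(1))
  have "of_int (p ^ v) * (of_int m * (c / fact k)) = c"
    unfolding mult.assoc[symmetric] f[symmetric] by simp
  then have "of_int (p ^ v) * (of_int m * (c / fact k)) \<in> pideal p (v + (k - v))"
    using assms vm by simp
  then have "of_int m * (c / fact k) \<in> pideal p (k - v)"
    by (simp only: p_power_mult_pideal_iff)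
  then have "c / fact k \<in> pideal p (k - v)"
    using vm(2) of_int_in_pideal_iff[of m 1]
    by (intro pideal_cancel_unit[OF pideal_of_int_0[of m] _ \<open>of_int m * (c / fact k) \<in> _\<close>]) simp
  then show ?thesis
    using vm by (intro pideal_mono[of "k div 2" "k - v"]) simp_all
qed

text \<open>Divide the linear factors out one after another. Each quotient has its coefficients determined from the
  top by those of \<open>B\<close>, so divisibility of the coefficients of \<open>B\<close> above the number of roots passes
  to the quotients, and for the last quotient it concerns every coefficient.\<close>

lemma coeff_in_pideal_of_many_roots:
  fixes B :: "rat poly"
  assumes "finite Z" "\<And>z. z \<in> Z \<Longrightarrow> poly B (of_nat z) = 0"
    and "\<And>k. k \<ge> card Z \<Longrightarrow> coeff B k \<in> pideal p e"
  shows "coeff B k \<in> pideal p e"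
  using assms
proof (induction Z arbitrary: B k rule: finite_induct)
  case (insert z Z)
  obtain R where R: "B = [:- of_nat z, 1:] * R"
    using insert.prems(1)[of z] by (auto simp: poly_eq_0_iff_dvd dvd_def)
  have B: "coeff B (Suc k) = coeff R k - of_nat z * coeff R (Suc k)" for k
    by (simp add: R)
  have top: "coeff R k \<in> pideal p e" if "k \<ge> card Z" for k
    using that
  proof (induction "degree R + 1 - k" arbitrary: k)
    case 0
    then show ?case by (simp add: coeff_eq_0)
  next
    case (Suc d)
    have "coeff R k = coeff B (Suc k) + of_nat z * coeff R (Suc k)"
      by (simp add: B)
    moreover have "coeff R (Suc k) \<in> pideal p e"
      using Suc by simp
    moreover have "coeff B (Suc k) \<in> pideal p e"
      using Suc.prems insert.hyps insert.prems(2)[of "Suc k"] by simp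
    ultimately show ?case by (simp add: pideal_add pideal_mult0)
  qed
  have roots: "poly R (of_nat y) = 0" if "y \<in> Z" for y
    using insert.prems(1)[of y] insert.hyps that by (auto simp: R)
  have "coeff R k \<in> pideal p e" for k
    by (rule insert.IH[OF roots top])
  then show ?case
    by (cases k) (auto simp: B R intro!: pideal_diff pideal_uminus pideal_mult0(1))
qed simp

text \<open>The Newton series of \<open>s\<close>, rewritten in falling factorials, has coefficients divisible by higher and higher
  powers of \<open>p\<close>. Its truncation is a polynomial that agrees with \<open>s\<close> as far as desired, and all but
  its first \<open>2 * e\<close> coefficients vanish modulo \<open>p\<^sup>e\<close>; having \<open>2 * e\<close> roots, it vanishes modulo \<open>p\<^sup>e\<close>
  altogether. Letting \<open>e\<close> grow leaves only the value zero.\<close>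

theorem diffs_divisible_infinitely_many_zeros:
  assumes s: "\<And>K. diffs_divisible p K 0 s" and inf: "infinite {n. s n = 0}"
  shows "s n = 0"
proof (rule pideal_all_imp_zero)
  fix e
  obtain Z where Z: "Z \<subseteq> {n. s n = 0}" "finite Z" "card Z = 2 * e"
    using infinite_arbitrarily_large[OF inf] by blast
  obtain K where K: "\<And>j. j \<in> insert n Z \<Longrightarrow> j \<le> K"
    using Z(2) finite_nat_set_iff_bounded_le[of "insert n Z"] by auto
  define b where "b k = (fdiff ^^ k) s 0 / fact k" for k
  have b: "b k \<in> pideal p (k div 2)" for k
    unfolding b_def using iterated_diff_in_pideal[OF s, of k k 0] by (intro div_fact_in_pideal) simp_all
  define B where "B = (\<Sum>k\<le>K. smult (b k) (falling_poly k))"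
  have eval: "poly B (of_nat j) = s j" if "j \<le> K" for j
  proof -
    have "poly B (of_nat j) = (\<Sum>k\<le>K. of_nat (j choose k) * (fdiff ^^ k) s 0)"
      by (simp add: B_def poly_sum poly_falling_poly b_def mult.commute)
    also have "\<dots> = (\<Sum>k\<le>j. of_nat (j choose k) * (fdiff ^^ k) s 0)"
      using that by (intro sum.mono_neutral_right) (auto simp: binomial_eq_0)
    finally show ?thesis by (simp flip: newton_forward)
  qed
  have "coeff B i \<in> pideal p e" if "i \<ge> card Z" for i
  proof -
    have "b k * coeff (falling_poly k) i \<in> pideal p e" for k
    proof (cases "k < i")
      case True
      then show ?thesis by (simp add: coeff_falling_poly_beyond)
    next
      case False
      then have "b k \<in> pideal p e"
        using that Z by (intro pideal_mono[OF _ b[of k]]) auto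
      then show ?thesis by (intro pideal_mult0 coeff_falling_poly_in_pideal)
    qed
    then show ?thesis by (simp add: B_def coeff_sum pideal_sum)
  qed
  moreover have "poly B (of_nat z) = 0" if "z \<in> Z" for z
    using that Z K eval by auto
  ultimately have "coeff B i \<in> pideal p e" for i
    using coeff_in_pideal_of_many_roots[OF Z(2)] by blast
  then have "poly B (of_nat n) \<in> pideal p e"
    unfolding poly_altdef by (intro pideal_sum pideal_mult0(2) pideal_power) auto
  then show "s n \<in> pideal p e" using eval K by simp
qed

lemma diffs_divisible_scale:
  "c \<in> pideal p 0 \<Longrightarrow> diffs_divisible p K 0 s \<Longrightarrow> diffs_divisible p K 0 (\<lambda>n. c * s n)"
  using diffs_divisible_mult[of K 0 "\<lambda>_. c" 0 s] diffs_divisible_const[of c 0 K] by simp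

lemma rapid_diffs_add:
  assumes "rapid_diffs p s" "rapid_diffs p t"
  shows "rapid_diffs p (\<lambda>n. s n + t n)"
proof -
  obtain d e where s: "\<And>K. diffs_divisible p K 0 (\<lambda>n. of_int (p ^ d) * s n)"
    and t: "\<And>K. diffs_divisible p K 0 (\<lambda>n. of_int (p ^ e) * t n)"
    using assms unfolding rapid_diffs_def by blast
  have "diffs_divisible p K 0 (\<lambda>n. of_int (p ^ e) * (of_int (p ^ d) * s n) +
      of_int (p ^ d) * (of_int (p ^ e) * t n))" for K
    by (rule diffs_divisible_add[OF diffs_divisible_scale[OF pideal_of_int_0 s]
          diffs_divisible_scale[OF pideal_of_int_0 t]])
  then have "diffs_divisible p K 0 (\<lambda>n. of_int (p ^ (d + e)) * (s n + t n))" for K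
    by (simp add: power_add algebra_simps)
  then show ?thesis unfolding rapid_diffs_def by blast
qed

lemma rapid_diffs_mult:
  assumes "rapid_diffs p s" "rapid_diffs p t"
  shows "rapid_diffs p (\<lambda>n. s n * t n)"
proof -
  obtain d e where s: "\<And>K. diffs_divisible p K 0 (\<lambda>n. of_int (p ^ d) * s n)"
    and t: "\<And>K. diffs_divisible p K 0 (\<lambda>n. of_int (p ^ e) * t n)"
    using assms unfolding rapid_diffs_def by blast
  have "diffs_divisible p K (0 + 0) (\<lambda>n. (of_int (p ^ d) * s n) * (of_int (p ^ e) * t n))" for K
    by (rule diffs_divisible_mult[OF s t])
  then have "diffs_divisible p K 0 (\<lambda>n. of_int (p ^ (d + e)) * (s n * t n))" for K
    by (simp add: power_add algebra_simps)
  then show ?thesis unfolding rapid_diffs_def by blast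
qed

lemma ex_p_power_mult_in_pideal: "\<exists>d. of_int (p ^ d) * r \<in> pideal p 0"
proof -
  obtain a b where ab: "b > 0" "r = of_int a / of_int b"
    by (rule quotient_denom)
  define d where "d = multiplicity p b"
  obtain b' where b': "b = p ^ d * b'" "\<not> p dvd b'"
    using ab p_gt_2 prime_p unfolding d_def
    by (metis multiplicity_decompose' not_prime_unit less_irrefl)
  have "b' \<noteq> 0"
    using b' by auto
  then have "(of_int (p ^ d) * r) * of_int b' = of_int (p ^ 0 * a)"
    using ab b' p_gt_2 by (simp add: field_simps)
  then show ?thesis using b' pidealI by blast
qed

lemma rapid_diffs_const: "rapid_diffs p (\<lambda>_. c)"
  unfolding rapid_diffs_def using ex_p_power_mult_in_pideal diffs_divisible_const by blast

lemma rapid_diffs_power: "rapid_diffs p s \<Longrightarrow> rapid_diffs p (\<lambda>n. s n ^ k)"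
  by (induction k) (auto intro: rapid_diffs_const rapid_diffs_mult)

lemma rapid_diffs_sum:
  "(\<And>i. i \<in> A \<Longrightarrow> rapid_diffs p (s i)) \<Longrightarrow> rapid_diffs p (\<lambda>n. \<Sum>i\<in>A. s i n)"
  by (induction A rule: infinite_finite_induct) (auto intro: rapid_diffs_const rapid_diffs_add)

lemma rapid_diffs_prod:
  "(\<And>i. i \<in> A \<Longrightarrow> rapid_diffs p (s i)) \<Longrightarrow> rapid_diffs p (\<lambda>n. \<Prod>i\<in>A. s i n)"
  by (induction A rule: infinite_finite_induct) (auto intro: rapid_diffs_const rapid_diffs_mult)

theorem rapid_diffs_infinitely_many_zeros:
  assumes "rapid_diffs p s" "infinite {n. s n = 0}"
  shows "s n = 0"
proof -
  obtain d where "\<And>K. diffs_divisible p K 0 (\<lambda>n. of_int (p ^ d) * s n)"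
    using assms unfolding rapid_diffs_def by blast
  then show ?thesis
    using diffs_divisible_infinitely_many_zeros[of "\<lambda>n. of_int (p ^ d) * s n" n] assms(2) p_gt_2
    by simp
qed

end

section \<open>Orbits of unicritical quadratics modulo an odd prime\<close>

definition qmap :: "rat \<Rightarrow> rat \<Rightarrow> rat" where
  "qmap c t = t\<^sup>2 + c"

text \<open>The derivative at \<open>u\<close> of the \<open>n\<close>-th iterate of \<open>qmap c\<close>, by the chain rule.\<close>

definition orbit_deriv :: "rat \<Rightarrow> rat \<Rightarrow> nat \<Rightarrow> rat" where
  "orbit_deriv c u n = (\<Prod>i<n. 2 * (qmap c ^^ i) u)"

lemma orbit_deriv_Suc: "orbit_deriv c u (Suc n) = orbit_deriv c u n * (2 * (qmap c ^^ n) u)"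
  by (simp add: orbit_deriv_def)

lemma orbit_deriv_add:
  "orbit_deriv c u (m + n) = orbit_deriv c u m * orbit_deriv c ((qmap c ^^ m) u) n"
proof (induction n)
  case (Suc n)
  have "(qmap c ^^ (m + n)) u = (qmap c ^^ n) ((qmap c ^^ m) u)"
    by (simp add: add.commute[of m] funpow_add)
  with Suc show ?case by (simp add: orbit_deriv_Suc)
qed (simp add: orbit_deriv_def)

context odd_prime begin

lemma qmap_pideal: "c \<in> pideal p 0 \<Longrightarrow> u \<in> pideal p 0 \<Longrightarrow> (qmap c ^^ n) u \<in> pideal p 0"
  by (induction n) (auto simp: qmap_def intro: pideal_add pideal_power)

lemma orbit_deriv_pideal:
  assumes "c \<in> pideal p 0" "u \<in> pideal p 0"
  shows "orbit_deriv c u n \<in> pideal p 0"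
proof (induction n)
  case (Suc n)
  have "2 * (qmap c ^^ n) u \<in> pideal p 0"
    using pideal_mult0(1)[OF pideal_of_int_0[of 2] qmap_pideal[OF assms]] by simp
  with Suc show ?case by (simp add: orbit_deriv_Suc pideal_mult0)
qed (simp add: orbit_deriv_def)

lemma two_notin_pideal: "2 \<notin> pideal p 1"
  using of_int_in_pideal_iff[of 2 1] p_gt_2 zdvd_not_zless[of 2 p] by auto

lemma orbit_deriv_unit:
  assumes c: "c \<in> pideal p 0" and u: "u \<in> pideal p 0"
    and unit: "\<And>i. i < n \<Longrightarrow> (qmap c ^^ i) u \<notin> pideal p 1"
  shows "orbit_deriv c u n \<notin> pideal p 1"
  using unit
proof (induction n)
  case 0
  then show ?case
    using of_int_in_pideal_iff[of 1 1] p_gt_2 by (auto simp: orbit_deriv_def)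
next
  case (Suc n)
  have two: "2 \<in> pideal p 0"
    using pideal_of_int_0[of 2] by simp
  have "2 * (qmap c ^^ n) u \<notin> pideal p 1"
    using Suc.prems by (intro pideal_mult_unit two two_notin_pideal qmap_pideal c u) simp
  moreover have "2 * (qmap c ^^ n) u \<in> pideal p 0"
    by (rule pideal_mult0(1)[OF two qmap_pideal[OF c u]])
  ultimately show ?case
    unfolding orbit_deriv_Suc
    using Suc by (intro pideal_mult_unit[OF orbit_deriv_pideal[OF c u]]) simp_all
qed

text \<open>The Taylor expansion of an iterate on the residue disc of \<open>u\<close>, with the linear term kept
  and the rest of the expansion divisible by \<open>p\<^sup>2\<close>.\<close>

lemma qmap_expansion:
  assumes c: "c \<in> pideal p 0" and u: "u \<in> pideal p 0"
  shows "\<exists>F\<in>integral_polyfun p. \<forall>y. (qmap c ^^ n) (u + of_int p * y) =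
           (qmap c ^^ n) u + of_int p * (orbit_deriv c u n * y + of_int p * F y)"
proof (induction n)
  case 0
  show ?case
    by (rule bexI[of _ "\<lambda>_. 0"])
       (auto simp: orbit_deriv_def intro!: integral_polyfun.const)
next
  case (Suc n)
  define v d where "v = (qmap c ^^ n) u" and "d = orbit_deriv c u n"
  obtain F where F: "F \<in> integral_polyfun p" and
    eq: "\<And>y. (qmap c ^^ n) (u + of_int p * y) = v + of_int p * (d * y + of_int p * F y)"
    using Suc by (auto simp: v_def d_def)
  define W where "W = (\<lambda>y. d * y + of_int p * F y)"
  define F' where "F' = (\<lambda>y. (2 * v) * F y + W y * W y)"
  have d: "d \<in> pideal p 0" and v: "2 * v \<in> pideal p 0"
    using orbit_deriv_pideal[OF c u] pideal_mult0(1)[OF pideal_of_int_0[of 2] qmap_pideal[OF c u]]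
    by (simp_all add: d_def v_def)
  have W: "W \<in> integral_polyfun p"
    unfolding W_def
    by (intro integral_polyfun.add integral_polyfun.mult integral_polyfun.const d
        pideal_of_int_0 integral_polyfun.ident F)
  have "F' \<in> integral_polyfun p"
    unfolding F'_def
    by (rule integral_polyfun.add[OF integral_polyfun.mult[OF integral_polyfun.const[OF v] F]
          integral_polyfun.mult[OF W W]])
  moreover have "(qmap c ^^ Suc n) (u + of_int p * y) =
      (qmap c ^^ Suc n) u + of_int p * (orbit_deriv c u (Suc n) * y + of_int p * F' y)" for y
  proof -
    have "(qmap c ^^ Suc n) (u + of_int p * y) = qmap c (v + of_int p * W y)"
      by (simp add: eq W_def)
    also have "\<dots> = qmap c v + of_int p * (2 * v * W y + of_int p * (W y * W y))"
      by (simp add: qmap_def power2_eq_square algebra_simps)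
    also have "\<dots> = qmap c v + of_int p * (d * (2 * v) * y + of_int p * F' y)"
      by (simp add: F'_def W_def algebra_simps)
    finally show ?thesis by (simp add: orbit_deriv_Suc d_def v_def)
  qed
  ultimately show ?case by blast
qed

text \<open>The return is asked for modulo \<open>p\<^sup>2\<close>, not just modulo \<open>p\<close>: after rescaling the disc by \<open>p\<close> the
  translation part of \<open>q\<^sup>M\<close> is then still divisible by \<open>p\<close>, and so is, by the assumption on the derivative,
  the deviation of its linear part from the identity.\<close>

lemma rapid_diffs_of_return:
  assumes c: "c \<in> pideal p 0" and u: "u \<in> pideal p 0"
    and return: "(qmap c ^^ M) u - u \<in> pideal p 2"
    and deriv: "orbit_deriv c u M - 1 \<in> pideal p 1"
  shows "rapid_diffs p (\<lambda>n. (qmap c ^^ (M * n)) u)"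
proof -
  define P :: rat where "P = of_int p"
  have P: "P \<noteq> 0" using p_gt_2 by (simp add: P_def)
  define b d where "b = ((qmap c ^^ M) u - u) / P\<^sup>2" and "d = (orbit_deriv c u M - 1) / P"
  have "of_int (p ^ 2) * b = (qmap c ^^ M) u - u"
    using P by (simp add: b_def P_def)
  then have b: "b \<in> pideal p 0"
    using return p_power_mult_pideal_iff[of 2 b 0] by simp
  have "of_int (p ^ 1) * d = orbit_deriv c u M - 1"
    using P by (simp add: d_def P_def)
  then have d: "d \<in> pideal p 0"
    using deriv p_power_mult_pideal_iff[of 1 d 0] by simp
  obtain F where F: "F \<in> integral_polyfun p" and
    eq: "\<And>y. (qmap c ^^ M) (u + P * y) = (qmap c ^^ M) u + P * (orbit_deriv c u M * y + P * F y)"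
    using qmap_expansion[OF c u, of M] unfolding P_def by blast
  \<comment> \<open>\<open>b\<close> is the displacement over \<open>p\<^sup>2\<close> and \<open>d\<close> the excess of the derivative over \<open>p\<close>, so \<open>q\<^sup>M\<close> becomes \<open>y + p * G y\<close>.\<close>
  define G where "G = (\<lambda>y. b + (d * y + F y))"
  have G: "G \<in> integral_polyfun p"
    unfolding G_def
    by (rule integral_polyfun.add[OF integral_polyfun.const[OF b]
          integral_polyfun.add[OF integral_polyfun.mult[OF integral_polyfun.const[OF d] integral_polyfun.ident] F]])
  have step: "(qmap c ^^ M) (u + P * y) = u + P * (y + P * G y)" for y
  proof -
    have "(qmap c ^^ M) u = u + P\<^sup>2 * b" "orbit_deriv c u M = 1 + P * d"
      using P by (simp_all add: b_def d_def)
    then show ?thesis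
      unfolding eq G_def by (simp add: power2_eq_square algebra_simps)
  qed
  define t where "t n = ((qmap c ^^ (M * n)) u - u) / P" for n
  have t: "(qmap c ^^ (M * n)) u = u + P * t n" for n
    using P by (simp add: t_def)
  have "t (Suc n) = t n + of_int p * G (t n)" for n
  proof -
    have "u + P * t (Suc n) = (qmap c ^^ M) ((qmap c ^^ (M * n)) u)"
      unfolding t[symmetric] by (simp add: funpow_add)
    also have "\<dots> = u + P * (t n + P * G (t n))"
      unfolding t step ..
    finally show ?thesis using P by (simp add: P_def)
  qed
  moreover have "t 0 \<in> pideal p 0"
    by (simp add: t_def)
  ultimately have "diffs_divisible p K 0 t" for K
    using near_identity_iteration_diffs_divisible[OF G] by blast
  then have "diffs_divisible p K 0 (\<lambda>n. of_int (p ^ 0) * t n)" for K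
    by simp
  then have "rapid_diffs p t"
    unfolding rapid_diffs_def by blast
  then show ?thesis
    unfolding t by (rule rapid_diffs_add[OF rapid_diffs_const rapid_diffs_mult[OF rapid_diffs_const]])
qed

lemma eventual_period_mod:
  fixes a :: "'a \<Rightarrow> nat \<Rightarrow> rat"
  assumes "finite A" and int: "\<And>x n. x \<in> A \<Longrightarrow> a x n \<in> pideal p 0"
  shows "\<exists>m M. M > 0 \<and> (\<forall>x\<in>A. a x (m + M) - a x m \<in> pideal p e)"
proof -
  define res where "res r = (SOME k. k \<in> {0..<p ^ e} \<and> r - of_int k \<in> pideal p e)" for r :: rat
  have res: "res r \<in> {0..<p ^ e}" "r - of_int (res r) \<in> pideal p e" if "r \<in> pideal p 0" for r
    using someI_ex[OF pideal_residue[OF that, of e, unfolded Bex_def]] by (auto simp: res_def)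
  define state where "state n = restrict (\<lambda>x. res (a x n)) A" for n
  have "range state \<subseteq> A \<rightarrow>\<^sub>E {0..<p ^ e}"
    using res int by (auto simp: state_def)
  then have "finite (range state)"
    by (rule finite_subset) (intro finite_PiE assms finite_atLeastLessThan_int)
  then have "\<not> inj state"
    using finite_imageD by auto
  then obtain m n where mn: "state m = state n" "m < n"
    by (metis injI linorder_neqE_nat)
  have "a x (m + (n - m)) - a x m \<in> pideal p e" if "x \<in> A" for x
  proof -
    have "res (a x m) = res (a x n)"
      using fun_cong[OF mn(1), of x] that by (simp add: state_def)
    then show ?thesis
      using pideal_diff[OF res(2)[OF int[OF that, of n]] res(2)[OF int[OF that, of m]]] mn by simp
  qed
  with mn show ?thesis by (intro exI[of _ m] exI[of _ "n - m"]) auto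
qed

text \<open>The pair of iterate and derivative evolves by an integral polynomial rule, so once it repeats modulo
  \<open>p\<^sup>2\<close> it keeps repeating with the same period.\<close>

lemma orbit_period_mod:
  assumes c: "c \<in> pideal p 0" and U: "finite U" "U \<subseteq> pideal p 0"
  shows "\<exists>m M. M > 0 \<and> (\<forall>u\<in>U. \<forall>l\<ge>m.
    (qmap c ^^ (l + M)) u - (qmap c ^^ l) u \<in> pideal p 2 \<and>
    orbit_deriv c u (l + M) - orbit_deriv c u l \<in> pideal p 2)"
proof -
  \<comment> \<open>The flag \<open>t\<close> selects between orbit and derivative, so one pigeonhole treats both.\<close>
  define a where "a = (\<lambda>(u, t) n. if t then (qmap c ^^ n) u else orbit_deriv c u n)"
  have "\<exists>m M. M > 0 \<and> (\<forall>x\<in>U \<times> UNIV. a x (m + M) - a x m \<in> pideal p 2)"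
    using U orbit_deriv_pideal[OF c] qmap_pideal[OF c]
    by (intro eventual_period_mod) (auto simp: a_def)
  then obtain m M where M: "M > 0"
    and *: "\<And>x. x \<in> U \<times> UNIV \<Longrightarrow> a x (m + M) - a x m \<in> pideal p 2"
    by blast
  have "(qmap c ^^ (l + M)) u - (qmap c ^^ l) u \<in> pideal p 2 \<and>
    orbit_deriv c u (l + M) - orbit_deriv c u l \<in> pideal p 2" if u: "u \<in> U" and "l \<ge> m" for u l
    using \<open>l \<ge> m\<close>
  proof (induction l rule: dec_induct)
    case base
    show ?case using *[of "(u, True)"] *[of "(u, False)"] u by (simp add: a_def)
  next
    case (step l)
    let ?x = "(qmap c ^^ (l + M)) u" and ?y = "(qmap c ^^ l) u"
    let ?d = "orbit_deriv c u (l + M)" and ?e = "orbit_deriv c u l"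
    have int: "?x \<in> pideal p 0" "?y \<in> pideal p 0" "?d \<in> pideal p 0"
      using u U qmap_pideal[OF c] orbit_deriv_pideal[OF c] by auto
    have two: "2 \<in> pideal p 0"
      using pideal_of_int_0[of 2] by simp
    have "qmap c ?x - qmap c ?y = (?x - ?y) * (?x + ?y)"
      by (simp add: qmap_def power2_eq_square algebra_simps)
    then have 1: "qmap c ?x - qmap c ?y \<in> pideal p 2"
      using step.IH int by (simp add: pideal_mult0 pideal_add)
    have "?d * (2 * ?x) - ?e * (2 * ?y) = 2 * (?d * (?x - ?y) + (?d - ?e) * ?y)"
      by (simp add: algebra_simps)
    moreover have "2 * (?d * (?x - ?y) + (?d - ?e) * ?y) \<in> pideal p 2"
      using step.IH int by (intro pideal_mult0(1)[OF two] pideal_add)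
        (auto intro: pideal_mult0)
    ultimately show ?case
      using 1 by (simp add: orbit_deriv_Suc)
  qed
  with M show ?thesis by blast
qed

text \<open>Where an orbit consists of units, its derivative is a unit and can be cancelled from the periodicity of
  derivatives, which leaves derivative one over a full period. An orbit in \<open>{0, -1}\<close> repeats exactly when
  it repeats modulo \<open>p\<^sup>2\<close>, so along the period it is constant.\<close>

theorem orbits_rapid_diffs:
  assumes c: "c \<in> pideal p 0" and U: "finite U" "U \<subseteq> pideal p 0"
    and ev: "\<And>u. u \<in> U \<Longrightarrow> (\<exists>N. \<forall>n\<ge>N. (qmap c ^^ n) u \<notin> pideal p 1) \<or>
               (\<exists>N. \<forall>n\<ge>N. (qmap c ^^ n) u \<in> {0, -1})"
  shows "\<exists>M N. M > 0 \<and> (\<forall>l\<ge>N. \<forall>u\<in>U. rapid_diffs p (\<lambda>n. (qmap c ^^ (l + M * n)) u))"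
proof -
  have "\<exists>N. \<forall>u\<in>U. (\<forall>n\<ge>N. (qmap c ^^ n) u \<notin> pideal p 1) \<or>
               (\<forall>n\<ge>N. (qmap c ^^ n) u \<in> {0, -1})"
  proof -
    have "\<forall>u\<in>U. \<exists>N. (\<forall>n\<ge>N. (qmap c ^^ n) u \<notin> pideal p 1) \<or> (\<forall>n\<ge>N. (qmap c ^^ n) u \<in> {0, -1})"
      using ev by meson
    then obtain N where N: "\<And>u. u \<in> U \<Longrightarrow> (\<forall>n\<ge>N u. (qmap c ^^ n) u \<notin> pideal p 1) \<or>
        (\<forall>n\<ge>N u. (qmap c ^^ n) u \<in> {0, -1})"
      by metis
    have "N u \<le> Max (N ` U)" if "u \<in> U" for u
      using that U by simp
    then show ?thesis
      using N by (intro exI[of _ "Max (N ` U)"]) (meson le_trans)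
  qed
  then obtain N where N: "\<And>u. u \<in> U \<Longrightarrow> (\<forall>n\<ge>N. (qmap c ^^ n) u \<notin> pideal p 1) \<or>
      (\<forall>n\<ge>N. (qmap c ^^ n) u \<in> {0, -1})"
    by blast
  \<comment> \<open>From time \<open>N\<close> on, an orbit that is eventually a unit has units as factors of its derivative.\<close>
  define V where "V = (qmap c ^^ N) ` U"
  have V: "finite V" "V \<subseteq> pideal p 0"
    using U qmap_pideal[OF c] by (auto simp: V_def)
  obtain m M where M: "M > 0" and per: "\<And>v l. v \<in> V \<Longrightarrow> l \<ge> m \<Longrightarrow>
      (qmap c ^^ (l + M)) v - (qmap c ^^ l) v \<in> pideal p 2 \<and>
      orbit_deriv c v (l + M) - orbit_deriv c v l \<in> pideal p 2"
    using orbit_period_mod[OF c V] by blast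
  have "rapid_diffs p (\<lambda>n. (qmap c ^^ (l + M * n)) u)" if l: "l \<ge> N + m" and u: "u \<in> U" for l u
  proof -
    define v k where "v = (qmap c ^^ N) u" and "k = l - N"
    have lk: "l = k + N" "k \<ge> m" using l by (auto simp: k_def)
    have v: "v \<in> V" "v \<in> pideal p 0" using u V by (auto simp: v_def V_def)
    have shift: "(qmap c ^^ (n + N)) u = (qmap c ^^ n) v" for n
      by (simp add: v_def funpow_add)
    show ?thesis
    proof (cases "\<forall>n\<ge>N. (qmap c ^^ n) u \<in> {0, -1}")
      case True
      have "(qmap c ^^ (l + M * n)) u = (qmap c ^^ l) u" for n
      proof (induction n)
        case (Suc n)
        let ?x = "(qmap c ^^ (l + M * Suc n)) u" and ?y = "(qmap c ^^ (l + M * n)) u"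
        have "?x - ?y \<in> pideal p 2"
          using per[OF v(1), of "k + M * n"] lk shift[of "k + M * Suc n"] shift[of "k + M * n"]
          by (simp add: algebra_simps)
        moreover have "?x \<in> {0, -1}" "?y \<in> {0, -1}"
          using True lk by simp_all
        moreover have "1 \<notin> pideal p 2" "- 1 \<notin> pideal p 2"
          using of_int_in_pideal_iff[of 1 2] of_int_in_pideal_iff[of "-1" 2] p_gt_2
          by (auto simp: power2_eq_square zmult_eq_1_iff)
        ultimately have "?x = ?y"
          by auto
        with Suc show ?case by simp
      qed simp
      then show ?thesis by (simp add: rapid_diffs_const)
    next
      case False
      then have unit: "(qmap c ^^ n) u \<notin> pideal p 1" if "n \<ge> N" for n
        using N[OF u] that by blast
      define w where "w = (qmap c ^^ k) v"
      have w: "w \<in> pideal p 0" using qmap_pideal[OF c v(2)] by (simp add: w_def)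
      have "(qmap c ^^ (k + M)) v = (qmap c ^^ M) w"
        by (simp add: w_def add.commute[of k] funpow_add)
      then have 1: "(qmap c ^^ M) w - w \<in> pideal p 2"
        using per[OF v(1) lk(2)] by (simp add: w_def)
      have "orbit_deriv c v k * (orbit_deriv c w M - 1) \<in> pideal p 2"
        using per[OF v(1) lk(2)] by (simp add: w_def orbit_deriv_add[of c v k M] right_diff_distrib)
      then have "orbit_deriv c v k * (orbit_deriv c w M - 1) \<in> pideal p 1"
        by (rule pideal_mono[rotated]) simp
      moreover have "orbit_deriv c v k \<notin> pideal p 1"
        using unit shift by (intro orbit_deriv_unit[OF c v(2)]) (metis le_add2)
      ultimately have 2: "orbit_deriv c w M - 1 \<in> pideal p 1"
        using pideal_cancel_unit[OF orbit_deriv_pideal[OF c v(2)]] by blast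
      have "(qmap c ^^ (l + M * n)) u = (qmap c ^^ (M * n)) w" for n
      proof -
        have "l + M * n = M * n + (k + N)" using lk by simp
        then show ?thesis by (simp only: funpow_add comp_apply w_def v_def)
      qed
      then show ?thesis
        using rapid_diffs_of_return[OF c w 1 2] by simp
    qed
  qed
  with M show ?thesis by blast
qed

end

section \<open>Primes modulo which the critical point is not periodic\<close>

text \<open>The orbit of the critical point \<open>0\<close> under \<open>qmap c\<close>, starting from its first iterate \<open>c\<close> and divided by \<open>c\<close>. Dividing out
  \<open>c\<close> removes the primes that divide every member of the orbit.\<close>

primrec crit :: "rat \<Rightarrow> nat \<Rightarrow> rat" where
  "crit c 0 = 1"
| "crit c (Suc n) = 1 + c * (crit c n)\<^sup>2"

lemma qmap_critical_orbit: "(qmap c ^^ Suc n) 0 = c * crit c n"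
  by (induction n) (simp_all add: qmap_def power2_eq_square algebra_simps)

context odd_prime begin

lemma crit_pideal: "c \<in> pideal p 0 \<Longrightarrow> crit c n \<in> pideal p 0"
  by (induction n) (auto intro!: pideal_add pideal_mult0 pideal_power)

lemma square_plus_cong:
  assumes c: "c \<in> pideal p 0" and x: "x \<in> pideal p 0" and y: "y \<in> pideal p 0"
    and xy: "x - y \<in> pideal p e"
  shows "(d + c * x\<^sup>2) - (d + c * y\<^sup>2) \<in> pideal p e"
proof -
  have "(d + c * x\<^sup>2) - (d + c * y\<^sup>2) = c * ((x - y) * (x + y))"
    by (simp add: power2_eq_square algebra_simps)
  then show ?thesis
    using pideal_mult0(1)[OF c pideal_mult0(2)[OF xy pideal_add[OF x y]]] by simp
qed

text \<open>Opposite numbers have the same image, so from \<open>Suc k\<close> on the critical orbit is constant modulo \<open>p\<close>.\<close>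

lemma crit_stationary:
  assumes c: "c \<in> pideal p 0" and k: "crit c k + crit c (Suc k) \<in> pideal p 1" and "m > k"
  shows "crit c m - crit c (Suc k) \<in> pideal p 1"
proof -
  have fixed: "crit c (Suc m) - crit c m \<in> pideal p 1" if "m > k" for m
    using that
  proof (induction m)
    case (Suc m)
    show ?case
    proof (cases "m = k")
      case True
      have "crit c (Suc k) - (- crit c k) \<in> pideal p 1"
        using k by (simp add: add.commute)
      from square_plus_cong[OF c crit_pideal[OF c] pideal_uminus[OF crit_pideal[OF c]] this, of 1]
      show ?thesis
        unfolding True by (simp only: crit.simps power2_minus)
    next
      case False
      then have "crit c (Suc m) - crit c m \<in> pideal p 1" using Suc by simp
      from square_plus_cong[OF c crit_pideal[OF c] crit_pideal[OF c] this, of 1] show ?thesis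
        by simp
    qed
  qed simp
  show ?thesis
    using \<open>m > k\<close>[THEN Suc_leI]
  proof (induction m rule: dec_induct)
    case (step m)
    then show ?case
      using pideal_add[OF fixed[of m] step.IH] by simp
  qed simp
qed

lemma crit_not_both_zero:
  assumes c: "c \<in> pideal p 0" and "crit c k \<in> pideal p 1" "crit c (Suc k) \<in> pideal p 1"
  shows False
proof -
  have "c * (crit c k)\<^sup>2 \<in> pideal p 1"
    unfolding power2_eq_square
    by (intro pideal_mult0(1)[OF c] pideal_mult0(1) crit_pideal[OF c] assms)
  then have "1 \<in> pideal p 1"
    using pideal_diff[OF assms(3), of "c * (crit c k)\<^sup>2"] by simp
  then show False
    using of_int_in_pideal_iff[of 1 1] p_gt_2 by auto
qed

text \<open>A second such coincidence would be between two copies of the value at which the orbit is stationary, so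
  this value would be zero modulo \<open>p\<close>; but zero is mapped to one.\<close>

lemma crit_antifixed_once:
  assumes c: "c \<in> pideal p 0" and k: "crit c k + crit c (Suc k) \<in> pideal p 1"
    and m: "crit c m + crit c (Suc m) \<in> pideal p 1" and "k < m"
  shows False
proof -
  have 1: "crit c m - crit c (Suc k) \<in> pideal p 1" "crit c (Suc m) - crit c (Suc k) \<in> pideal p 1"
    "crit c (Suc (Suc k)) - crit c (Suc k) \<in> pideal p 1"
    using \<open>k < m\<close> by (intro crit_stationary[OF c k]; simp)+
  have "2 * crit c (Suc k) = (crit c m + crit c (Suc m)) -
      ((crit c m - crit c (Suc k)) + (crit c (Suc m) - crit c (Suc k)))"
    by simp
  then have "2 * crit c (Suc k) \<in> pideal p 1"
    using pideal_diff[OF m pideal_add[OF 1(1,2)]] by simp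
  then have 2: "crit c (Suc k) \<in> pideal p 1"
    using pideal_cancel_unit[of 2 "crit c (Suc k)" 1] two_notin_pideal pideal_of_int_0[of 2] by simp
  show False
    using crit_not_both_zero[OF c 2] pideal_add[OF 1(3) 2] by (simp del: crit.simps)
qed

text \<open>If \<open>0\<close> were periodic modulo \<open>p\<close>, a periodic orbit that is eventually constant would be constant, and its
  value, being its own opposite, would be zero. A prime dividing \<open>c\<close> is excluded because then
  \<open>crit c\<close> is one modulo \<open>p\<close>.\<close>

lemma critical_orbit_unit:
  assumes c: "c \<in> pideal p 0" and k: "crit c k + crit c (Suc k) \<in> pideal p 1" and "n > 0"
  shows "(qmap c ^^ n) 0 \<notin> pideal p 1"
proof -
  have two: "2 \<in> pideal p 0" using pideal_of_int_0[of 2] by simp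
  obtain j where j: "n = Suc j" using \<open>n > 0\<close> by (cases n) auto
  have cu: "c \<notin> pideal p 1"
  proof
    assume c1: "c \<in> pideal p 1"
    have *: "crit c m - 1 \<in> pideal p 1" for m
      using pideal_mult0(2)[OF c1 pideal_power[OF crit_pideal[OF c]]] by (cases m) simp_all
    have "crit c k + crit c (Suc k) - ((crit c k - 1) + (crit c (Suc k) - 1)) \<in> pideal p 1"
      by (intro pideal_diff k pideal_add *)
    then show False using two_notin_pideal by simp
  qed
  have "crit c j \<notin> pideal p 1"
  proof
    assume j: "crit c j \<in> pideal p 1"
    have per: "crit c (Suc (m + j)) - crit c m \<in> pideal p 1" for m
    proof (induction m)
      case 0
      show ?case
        using pideal_mult0(1)[OF c pideal_mult0(1)[OF crit_pideal[OF c] j]]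
        by (simp add: power2_eq_square)
    next
      case (Suc m)
      from square_plus_cong[OF c crit_pideal[OF c] crit_pideal[OF c] Suc, of 1]
      show ?case by (simp only: crit.simps add_Suc)
    qed
    have 1: "crit c (Suc (k + j)) - crit c (Suc k) \<in> pideal p 1"
      by (rule crit_stationary[OF c k]) simp
    have "crit c k - crit c (Suc k) \<in> pideal p 1"
      using pideal_diff[OF per[of k] 1] pideal_uminus[of "crit c (Suc k) - crit c k" 1] by (simp del: crit.simps)
    from pideal_add[OF k this] have "2 * crit c k \<in> pideal p 1"
      by (simp del: crit.simps)
    then have k0: "crit c k \<in> pideal p 1"
      using pideal_cancel_unit[OF two two_notin_pideal] by blast
    have "crit c (Suc k) \<in> pideal p 1"
      using pideal_diff[OF k k0] by (simp del: crit.simps)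
    with crit_not_both_zero[OF c k0] show False by blast
  qed
  then show ?thesis
    unfolding j qmap_critical_orbit
    by (intro pideal_mult_unit c cu crit_pideal)
qed

text \<open>After the first visit to \<open>0\<close> modulo \<open>p\<close> the orbit follows the critical orbit, which does not come back.\<close>

lemma orbit_eventually_unit:
  assumes c: "c \<in> pideal p 0" and u: "u \<in> pideal p 0"
    and nonper: "\<And>n. n > 0 \<Longrightarrow> (qmap c ^^ n) 0 \<notin> pideal p 1"
  shows "\<exists>N. \<forall>n\<ge>N. (qmap c ^^ n) u \<notin> pideal p 1"
proof (cases "\<exists>m. (qmap c ^^ m) u \<in> pideal p 1")
  case True
  then obtain m where m: "(qmap c ^^ m) u \<in> pideal p 1" by blast
  have cong: "(qmap c ^^ n) ((qmap c ^^ m) u) - (qmap c ^^ n) 0 \<in> pideal p 1" for n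
  proof (induction n)
    case (Suc n)
    from square_plus_cong[OF pideal_1 qmap_pideal[OF c qmap_pideal[OF c u]] qmap_pideal[OF c pideal_0] Suc, of c]
    show ?case by (simp add: qmap_def add.commute)
  qed (use m in simp)
  have "(qmap c ^^ n) u \<notin> pideal p 1" if "n \<ge> Suc m" for n
  proof
    assume n: "(qmap c ^^ n) u \<in> pideal p 1"
    have "(qmap c ^^ n) u = (qmap c ^^ (n - m)) ((qmap c ^^ m) u)"
      using that by (simp flip: funpow_add comp_apply[of "(qmap c ^^ (n - m))"])
    then have "(qmap c ^^ (n - m)) 0 \<in> pideal p 1"
      using pideal_diff[OF n cong[of "n - m"]] by simp
    then show False using nonper[of "n - m"] that by simp
  qed
  then show ?thesis by blast
qed blast

end

primrec crit_denom :: "int \<Rightarrow> nat \<Rightarrow> int" where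
  "crit_denom v 0 = 1"
| "crit_denom v (Suc n) = v * (crit_denom v n)\<^sup>2"

text \<open>For \<open>c = a / v\<close>, the fraction \<open>crit_numer a v n / crit_denom v n\<close> is \<open>crit c n\<close>.\<close>

primrec crit_numer :: "int \<Rightarrow> int \<Rightarrow> nat \<Rightarrow> int" where
  "crit_numer a v 0 = 1"
| "crit_numer a v (Suc n) = crit_denom v (Suc n) + a * (crit_numer a v n)\<^sup>2"

text \<open>The numerator of \<open>crit c n + crit c (Suc n)\<close> over the denominator \<open>crit_denom v (Suc n)\<close>, for \<open>c = a / v\<close>.\<close>

definition antifix :: "int \<Rightarrow> int \<Rightarrow> nat \<Rightarrow> int" where
  "antifix a v n = v * crit_denom v n * crit_numer a v n + crit_numer a v (Suc n)"

lemma crit_denom_pos: "v > 0 \<Longrightarrow> crit_denom v n > 0"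
  by (induction n) auto

lemma crit_conv_fraction:
  assumes "v > 0"
  shows "crit (of_int a / of_int v) n * of_int (crit_denom v n) = of_int (crit_numer a v n)"
proof (induction n)
  case (Suc n)
  let ?c = "of_int a / of_int v :: rat" and ?t = "of_int (crit_denom v n) :: rat"
  have "crit ?c (Suc n) * of_int (crit_denom v (Suc n)) =
      of_int v * ?t\<^sup>2 + of_int a * (crit ?c n * ?t)\<^sup>2"
    using assms by (simp add: field_simps power2_eq_square)
  also have "\<dots> = of_int (crit_numer a v (Suc n))"
    unfolding Suc by simp
  finally show ?case .
qed simp

lemma antifix_conv_crit:
  assumes "v > 0"
  shows "(crit (of_int a / of_int v) n + crit (of_int a / of_int v) (Suc n)) *
      of_int (crit_denom v (Suc n)) = of_int (antifix a v n)"
proof -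
  let ?z = "crit (of_int a / of_int v)"
  have "of_int (antifix a v n) = of_int v * of_int (crit_denom v n) * (?z n * of_int (crit_denom v n))
      + ?z (Suc n) * of_int (crit_denom v (Suc n))"
    unfolding crit_conv_fraction[OF assms] antifix_def by simp
  also have "\<dots> = (?z n + ?z (Suc n)) * of_int (crit_denom v (Suc n))"
    by (simp add: power2_eq_square algebra_simps)
  finally show ?thesis by simp
qed

lemma not_dvd_crit_denom: "prime p \<Longrightarrow> \<not> p dvd v \<Longrightarrow> \<not> p dvd crit_denom v n" for p v :: int
  by (induction n) (auto simp: prime_dvd_mult_iff prime_dvd_power_iff)

lemma (in odd_prime) dvd_antifix_imp:
  assumes "v > 0" "\<not> p dvd v" "p dvd antifix a v n"
  shows "crit (of_int a / of_int v) n + crit (of_int a / of_int v) (Suc n) \<in> pideal p 1"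
proof -
  obtain k where "antifix a v n = p * k" using assms(3) by blast
  then show ?thesis
    using antifix_conv_crit[OF assms(1), of a n] not_dvd_crit_denom[OF prime_p assms(2), of "Suc n"]
    by (intro pidealI[of p "crit_denom v (Suc n)" _ 1 k]) simp_all
qed

lemma prime_dvd_antifix_not_dvd_denom:
  assumes "prime p" "coprime a v" "p dvd antifix a v n"
  shows "\<not> p dvd v"
proof
  assume v: "p dvd v"
  then have a: "\<not> p dvd a"
    using assms by (metis coprime_common_divisor not_prime_unit)
  have Z: "\<not> p dvd crit_numer a v n" for n
  proof (induction n)
    case 0
    then show ?case using assms(1) by (auto dest: not_prime_unit)
  next
    case (Suc n)
    have "p dvd crit_denom v (Suc n)" using v by simp
    moreover have "\<not> p dvd a * (crit_numer a v n)\<^sup>2"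
      using Suc a assms(1) by (simp add: prime_dvd_mult_iff prime_dvd_power_iff)
    ultimately show ?case by (simp only: crit_numer.simps dvd_add_right_iff) simp
  qed
  have "p dvd v * crit_denom v n * crit_numer a v n"
    using v by simp
  then have "p dvd crit_numer a v (Suc n)"
    using assms(3) unfolding antifix_def by (simp only: dvd_add_right_iff)
  with Z show False by blast
qed

lemma odd_square_mod4: "odd x \<Longrightarrow> 4 dvd x\<^sup>2 - 1" for x :: int
proof (elim oddE)
  fix y assume "x = 2 * y + 1"
  then have "x\<^sup>2 - 1 = 4 * (y\<^sup>2 + y)" by (simp add: power2_eq_square algebra_simps)
  then show "4 dvd x\<^sup>2 - 1" by simp
qed

text \<open>Unless \<open>v\<close> is odd and \<open>a\<close> even, the number is odd. In the remaining case squares of odd numbers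
  are one modulo \<open>4\<close>, and the recursion gives \<open>2 * (v + a)\<close> modulo \<open>4\<close>. The index \<open>0\<close> is different because
  \<open>crit_denom v 0\<close> is \<open>1\<close> instead of \<open>v\<close> modulo \<open>4\<close>.\<close>

lemma not_4_dvd_antifix:
  assumes "coprime a v" "n > 0"
  shows "\<not> 4 dvd antifix a v n"
proof -
  have odd_numer: "odd (crit_numer a v n)" if "even v \<or> even a" for n
  proof (induction n)
    case (Suc n)
    have "odd v \<or> odd a" using coprime_common_divisor[OF assms(1), of 2] by auto
    moreover have "odd (crit_denom v n)" if "odd v" for n
      using that by (induction n) auto
    ultimately show ?case using Suc that by auto
  qed simp
  have odd_denom: "odd (crit_denom v n)" if "odd v" for n
    using that by (induction n) auto
  show ?thesis
  proof (cases "odd v \<and> even a")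
    case False
    have "odd (antifix a v n)"
    proof (cases "odd v")
      case True
      then have "odd a" using False by simp
      then show ?thesis using True odd_denom by (auto simp: antifix_def)
    next
      case False
      then show ?thesis using odd_numer[of "Suc n"] by (auto simp: antifix_def)
    qed
    then show ?thesis using dvd_trans[of 2 4 "antifix a v n"] by auto
  next
    case True
    obtain m where n: "n = Suc m" using assms(2) by (cases n) auto
    have sq: "4 dvd (crit_denom v k)\<^sup>2 - 1" "4 dvd (crit_numer a v k)\<^sup>2 - 1" for k
      using True odd_denom odd_numer by (auto intro: odd_square_mod4)
    have t: "4 dvd crit_denom v (Suc k) - v" for k
      using dvd_mult[OF sq(1)[of k], of v] by (simp add: algebra_simps)
    have z: "4 dvd crit_numer a v (Suc k) - (v + a)" for k
      using dvd_add[OF t[of k] dvd_mult[OF sq(2)[of k], of a]] by (simp add: algebra_simps)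
    have "antifix a v n - 2 * (v + a) =
        v * (crit_denom v n - v) * crit_numer a v n + v * v * (crit_numer a v n - (v + a))
        + (v\<^sup>2 - 1) * (v + a) + (crit_numer a v (Suc n) - (v + a))"
      unfolding antifix_def power2_eq_square by (simp add: algebra_simps del: crit_numer.simps)
    also have "4 dvd \<dots>"
    proof (intro dvd_add)
      show "4 dvd v * (crit_denom v n - v) * crit_numer a v n"
        unfolding n by (intro dvd_mult2[OF dvd_mult[OF t]])
      show "4 dvd v * v * (crit_numer a v n - (v + a))"
        unfolding n by (rule dvd_mult[OF z])
      show "4 dvd (v\<^sup>2 - 1) * (v + a)"
        using True by (intro dvd_mult2 odd_square_mod4) simp
      show "4 dvd crit_numer a v (Suc n) - (v + a)"
        by (rule z)
    qed
    finally have *: "4 dvd antifix a v n - 2 * (v + a)" .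
    have "\<not> 4 dvd 2 * (v + a)"
      using True by presburger
    show ?thesis
    proof
      assume "4 dvd antifix a v n"
      from dvd_diff[OF this *] have "4 dvd 2 * (v + a)"
        by (simp only: diff_diff_eq2 add_diff_cancel_left')
      with \<open>\<not> 4 dvd 2 * (v + a)\<close> show False ..
    qed
  qed
qed

lemma abs_le_2_of_no_odd_prime_factor:
  fixes w :: int
  assumes "w \<noteq> 0" "\<not> 4 dvd w" "\<And>p. prime p \<Longrightarrow> p > 2 \<Longrightarrow> \<not> p dvd w"
  shows "\<bar>w\<bar> \<le> 2"
proof -
  have small: "\<bar>m\<bar> \<le> 1" if m: "odd m" "m dvd w" for m
  proof (rule ccontr)
    assume "\<not> \<bar>m\<bar> \<le> 1"
    then obtain q where q: "prime q" "q dvd m"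
      using prime_divisor_exists[of m] m by (auto simp: zdvd1_eq)
    then have "q \<noteq> 2" "q \<ge> 2" using m prime_ge_2_int by auto
    then show False
      using assms(3)[OF q(1)] dvd_trans[OF q(2) m(2)] by simp
  qed
  show ?thesis
  proof (cases "even w")
    case True
    then obtain m where m: "w = 2 * m" by blast
    then have "odd m" using assms(2) by auto
    then show ?thesis using small[of m] m by simp
  next
    case False
    then show ?thesis using small[of w] by simp
  qed
qed

text \<open>For \<open>a \<ge> 1\<close> all terms are positive; for \<open>a \<le> -3\<close> the quadratic term dominates once the critical orbit
  has reached absolute value \<open>2\<close>, which it does in one step.\<close>

lemma antifix_unbounded_integer:
  assumes "a \<notin> {0, -1, -2}"
  shows "\<bar>antifix a 1 (Suc n)\<bar> > 2"
proof -
  have T: "crit_denom 1 n = 1" for n by (induction n) auto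
  let ?Z = "crit_numer a 1"
  have W: "antifix a 1 n = ?Z n + 1 + a * (?Z n)\<^sup>2" for n
    by (simp add: antifix_def T)
  consider "a \<ge> 1" | "a \<le> -3" using assms by force
  then show ?thesis
  proof cases
    case 1
    have "?Z n \<ge> 1" for n by (induction n) (use 1 in \<open>auto simp: T\<close>)
    moreover have "a * (?Z (Suc n))\<^sup>2 \<ge> 1 * 1"
      using 1 calculation[of "Suc n"] by (intro mult_mono) (auto simp: one_le_power)
    ultimately show ?thesis using W[of "Suc n"] by (smt (verit))
  next
    case 2
    have sq: "a * z\<^sup>2 \<le> - 3 * z\<^sup>2" for z :: int
      using 2 by (intro mult_right_mono) auto
    have big: "z\<^sup>2 \<ge> 2 * \<bar>z\<bar>" if "\<bar>z\<bar> \<ge> 2" for z :: int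
      using mult_right_mono[OF that, of "\<bar>z\<bar>"] by (simp add: power2_eq_square abs_mult_self_eq)
    have Z: "\<bar>?Z (Suc n)\<bar> \<ge> 2" for n
    proof (induction n)
      case 0
      then show ?case using 2 by (simp add: T)
    next
      case (Suc n)
      have "?Z (Suc (Suc n)) = 1 + a * (?Z (Suc n))\<^sup>2"
        by (simp add: T)
      then show ?case using sq[of "?Z (Suc n)"] big[OF Suc] Suc by linarith
    qed
    show ?thesis
      using W[of "Suc n"] sq[of "?Z (Suc n)"] big[OF Z[of n]] Z[of n] by linarith
  qed
qed

text \<open>If the numerators were bounded, the growing denominators would force consecutive members \<open>z n\<close> of the
  critical orbit to add up to almost zero. The difference \<open>d n\<close> of consecutive members is multiplied by \<open>c\<close> times
  this sum in every step, so it tends to zero as well. Then \<open>z\<close> tends to zero, which contradicts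
  \<open>z (Suc n) = 1 + c * (z n)\<^sup>2\<close>.\<close>

lemma antifix_unbounded_fraction:
  assumes v: "v \<ge> 2" and a: "a \<noteq> 0"
  shows "\<exists>n\<ge>K. \<bar>antifix a v n\<bar> > 2"
proof (rule ccontr)
  assume "\<not> ?thesis"
  then have small: "\<bar>antifix a v n\<bar> \<le> 2" if "n \<ge> K" for n
    using that by force
  define c :: rat where "c = of_int a / of_int v"
  define c' where "c' = (of_rat c :: real)"
  define z where "z n = (of_rat (crit c n) :: real)" for n
  define y where "y n = z n + z (Suc n)" for n
  define d where "d n = z (Suc n) - z n" for n
  have c0: "c' \<noteq> 0" using a v by (simp add: c'_def c_def)
  have z_Suc: "z (Suc n) = 1 + c' * (z n)\<^sup>2" for n
    by (simp add: z_def c'_def of_rat_add of_rat_mult of_rat_power)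
  have T: "crit_denom v (Suc n) \<ge> 2 ^ Suc n" for n
  proof (induction n)
    case (Suc n)
    have "(2::int) ^ Suc (Suc n) \<le> 2 * crit_denom v (Suc n)"
      using Suc by simp
    also have "\<dots> \<le> v * crit_denom v (Suc n)"
      using v crit_denom_pos[of v "Suc n"] by (intro mult_right_mono) auto
    also have "\<dots> \<le> v * (crit_denom v (Suc n))\<^sup>2"
      using v crit_denom_pos[of v "Suc n"]
      by (intro mult_left_mono) (auto simp: self_le_power simp del: crit_denom.simps)
    finally show ?case by simp
  qed (use v in simp)
  have y_bound: "\<bar>y n\<bar> \<le> 2 * (1 / 2) ^ n" if "n \<ge> K" for n
  proof -
    have "(crit c n + crit c (Suc n)) * of_int (crit_denom v (Suc n)) = of_int (antifix a v n)"
      unfolding c_def using v by (intro antifix_conv_crit) simp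
    then have "(of_rat ((crit c n + crit c (Suc n)) * of_int (crit_denom v (Suc n))) :: real) =
        of_rat (of_int (antifix a v n))"
      by simp
    then have "y n * of_int (crit_denom v (Suc n)) = of_int (antifix a v n)"
      by (simp add: of_rat_mult of_rat_add y_def z_def del: crit.simps crit_denom.simps)
    then have "\<bar>y n\<bar> * of_int (crit_denom v (Suc n)) = of_int \<bar>antifix a v n\<bar>"
      using crit_denom_pos[of v "Suc n"] v
      by (metis abs_mult abs_of_pos less_le_trans of_int_0_less_iff of_int_abs zero_less_numeral)
    then have 1: "\<bar>y n\<bar> * of_int (crit_denom v (Suc n)) \<le> 2"
      using small[OF that] by simp
    have "\<bar>y n\<bar> * 2 ^ n \<le> \<bar>y n\<bar> * of_int (crit_denom v (Suc n))"
    proof (intro mult_left_mono)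
      have "(2::int) ^ n \<le> crit_denom v (Suc n)"
        using T[of n] power_increasing[of n "Suc n" "2::int"] by linarith
      then have "real_of_int (2 ^ n) \<le> of_int (crit_denom v (Suc n))"
        by (simp only: of_int_le_iff)
      then show "2 ^ n \<le> real_of_int (crit_denom v (Suc n))" by simp
    qed simp
    with 1 have "\<bar>y n\<bar> * 2 ^ n \<le> 2" by linarith
    then show ?thesis by (simp add: field_simps power_one_over)
  qed
  have y: "y \<longlonglongrightarrow> 0"
  proof (rule tendsto_0_le[where K = 1])
    show "eventually (\<lambda>n. norm (y n) \<le> norm (2 * (1 / 2) ^ n :: real) * 1) sequentially"
      using y_bound by (auto simp: eventually_sequentially)
    show "(\<lambda>n. 2 * (1 / 2) ^ n :: real) \<longlonglongrightarrow> 0"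
      by (intro tendsto_mult_right_zero LIMSEQ_realpow_zero) auto
  qed
  have d_Suc: "d (Suc n) = c' * d n * y n" for n
    by (simp add: d_def y_def z_Suc power2_eq_square algebra_simps)
  have "(\<lambda>n. c' * y n) \<longlonglongrightarrow> 0"
    using y by (rule tendsto_mult_right_zero)
  then obtain L where L: "\<And>n. n \<ge> L \<Longrightarrow> \<bar>c' * y n\<bar> < 1"
    by (force dest: LIMSEQ_D[where r = 1])
  have d_bound: "\<bar>d n\<bar> \<le> \<bar>d L\<bar>" if "n \<ge> L" for n
    using that
  proof (induction n rule: dec_induct)
    case (step n)
    have "\<bar>d (Suc n)\<bar> = \<bar>c' * y n\<bar> * \<bar>d n\<bar>"
      by (simp add: d_Suc abs_mult algebra_simps)
    also have "\<dots> \<le> 1 * \<bar>d L\<bar>"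
      using L[of n] step by (intro mult_mono) auto
    finally show ?case by simp
  qed simp
  have "(\<lambda>n. d (Suc n)) \<longlonglongrightarrow> 0"
  proof (rule tendsto_0_le[where K = 1])
    have "norm (d (Suc n)) \<le> norm (\<bar>d L\<bar> * \<bar>c' * y n\<bar>) * 1" if "n \<ge> L" for n
      using mult_right_mono[OF d_bound[OF that], of "\<bar>c' * y n\<bar>"]
      by (simp add: d_Suc abs_mult algebra_simps)
    then show "eventually (\<lambda>n. norm (d (Suc n)) \<le> norm (\<bar>d L\<bar> * \<bar>c' * y n\<bar>) * 1) sequentially"
      by (auto simp: eventually_sequentially)
    show "(\<lambda>n. \<bar>d L\<bar> * \<bar>c' * y n\<bar>) \<longlonglongrightarrow> 0"
      using y
      by (intro tendsto_mult_right_zero tendsto_rabs_zero)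
  qed
  then have "d \<longlonglongrightarrow> 0"
    by (rule LIMSEQ_imp_Suc)
  then have "(\<lambda>n. (y n - d n) / 2) \<longlonglongrightarrow> (0 - 0) / 2"
    using y by (intro tendsto_intros) auto
  then have z: "z \<longlonglongrightarrow> 0"
    by (simp add: y_def d_def)
  then have "(\<lambda>n. z (Suc n)) \<longlonglongrightarrow> 1 + c' * 0\<^sup>2"
    unfolding z_Suc by (intro tendsto_intros)
  moreover have "(\<lambda>n. z (Suc n)) \<longlonglongrightarrow> 0"
    using z by (rule LIMSEQ_Suc)
  ultimately show False
    using LIMSEQ_unique by fastforce
qed

text \<open>Every odd prime occurs in at most one of the numerators, so if only the finitely many primes up to \<open>B\<close> occurred, all
  late numerators would have no odd prime factor, hence be \<open>1\<close> or \<open>2\<close> up to sign.\<close>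

lemma infinitely_many_antifix_primes:
  assumes "v > 0" "coprime a v" and c: "of_int a / of_int v \<notin> {0, -1 :: rat}"
  shows "\<exists>p n. prime p \<and> p > B \<and> p > 2 \<and> \<not> p dvd v \<and> p dvd antifix a v n"
proof (rule ccontr)
  assume contra: "\<not> ?thesis"
  have nz: "antifix a v n \<noteq> 0" for n
  proof
    assume 0: "antifix a v n = 0"
    obtain p where "prime p" "p > nat (max (max B 2) v)"
      using bigger_prime by blast
    then have "prime (int p)" "int p > B" "int p > 2" "int p > v"
      by auto
    moreover from this have "\<not> int p dvd v"
      using assms(1) zdvd_not_zless by blast
    ultimately show False using contra 0 by (metis dvd_0_right)
  qed
  define P where "P = {p. prime p \<and> p > 2 \<and> (\<exists>n. p dvd antifix a v n)}"
  have "P \<subseteq> {0..B}"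
  proof
    fix p assume "p \<in> P"
    then obtain n where p: "prime p" "p > 2" "p dvd antifix a v n"
      by (auto simp: P_def)
    then have "\<not> p dvd v"
      using prime_dvd_antifix_not_dvd_denom[OF _ assms(2)] by blast
    with p contra have "\<not> p > B" by blast
    with p show "p \<in> {0..B}" by simp
  qed
  then have "finite P" by (rule finite_subset) simp
  have once: "m = n" if "p \<in> P" "p dvd antifix a v m" "p dvd antifix a v n" for p m n
  proof -
    interpret odd_prime p
      by standard (use that in \<open>auto simp: P_def\<close>)
    have v: "\<not> p dvd v"
      by (rule prime_dvd_antifix_not_dvd_denom[OF prime_p assms(2) that(2)])
    then have "of_int a / of_int v \<in> pideal p 0"
      using assms(1) by (intro pidealI[of p v _ 0 a]) auto
    then show ?thesis
      using crit_antifixed_once dvd_antifix_imp[OF assms(1) v] that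
      by (metis linorder_neqE_nat)
  qed
  \<comment> \<open>The only index whose numerator is divisible by \<open>p\<close>.\<close>
  define idx where "idx p = (THE n. p dvd antifix a v n)" for p
  have idx: "n = idx p" if "p \<in> P" "p dvd antifix a v n" for p n
    unfolding idx_def using once that by (intro the_equality[symmetric]) auto
  obtain K where K: "\<And>n. n \<in> idx ` P \<Longrightarrow> n < K"
    using finite_nat_set_iff_bounded[of "idx ` P"] \<open>finite P\<close> by auto
  have small: "\<bar>antifix a v n\<bar> \<le> 2" if "n \<ge> Suc K" for n
  proof (rule abs_le_2_of_no_odd_prime_factor[OF nz not_4_dvd_antifix[OF assms(2)]])
    fix p :: int
    assume p: "prime p" "p > 2"
    show "\<not> p dvd antifix a v n"
    proof
      assume dvd: "p dvd antifix a v n"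
      with p have "p \<in> P" by (auto simp: P_def)
      with K[of n] idx[OF this dvd] that show False by auto
    qed
  qed (use that in simp)
  show False
  proof (cases "v = 1")
    case True
    have "a \<noteq> -2" using nz[of 0] True by (auto simp: antifix_def)
    then have "a \<notin> {0, -1, -2}" using c True by auto
    then show False
      using antifix_unbounded_integer[of a K] small[of "Suc K"] True by simp
  next
    case False
    then show False
      using antifix_unbounded_fraction[of v a "Suc K"] assms c small by force
  qed
qed

text \<open>Fermat descent, which works for all \<open>n\<close> and so needs no primality: take \<open>b\<close> odd and at most \<open>n\<close>
  with \<open>n dvd b\<^sup>2 - 2\<close>. As \<open>b\<^sup>2 - 2\<close> is \<open>7\<close> modulo \<open>8\<close>, the cofactor is again \<open>3\<close> or \<open>5\<close> modulo \<open>8\<close>, and it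
  is smaller than \<open>n\<close>.\<close>

lemma two_nonresidue:
  fixes n :: int
  assumes "n > 0" "n mod 8 \<in> {3, 5}"
  shows "\<not> n dvd a\<^sup>2 - 2"
  using assms
proof (induction "nat n" arbitrary: n a rule: less_induct)
  case less
  show ?case
  proof
    assume dvd: "n dvd a\<^sup>2 - 2"
    have n: "n \<ge> 3" "odd n" using less.prems by (auto, presburger+)
    define r where "r = a mod n"
    define b where "b = (if odd r then r else n - r)"
    have r: "0 \<le> r" "r < n" using n by (auto simp: r_def)
    have b: "odd b" "0 < b" "b < n \<or> b = n"
      using r n by (cases "r = 0"; auto simp: b_def)+
    have ra: "n dvd r - a"
      by (simp add: r_def mod_eq_dvd_iff[symmetric])
    have "n dvd (b - a) * (b + a)"
    proof (cases "odd r")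
      case True
      then show ?thesis using ra by (simp add: b_def)
    next
      case False
      then have "b + a = n - (r - a)" by (simp add: b_def)
      then have "n dvd b + a" using dvd_diff[OF dvd_refl ra] by (simp only:)
      then show ?thesis by simp
    qed
    moreover have "b\<^sup>2 - 2 = (b - a) * (b + a) + (a\<^sup>2 - 2)"
      by (simp add: power2_eq_square algebra_simps)
    ultimately have "n dvd b\<^sup>2 - 2"
      using dvd_add[OF _ dvd] by (simp only:)
    then obtain m where m: "b\<^sup>2 - 2 = n * m" by blast
    obtain l where "b\<^sup>2 = 1 + 8 * l"
    proof -
      obtain k where k: "b = 2 * k + 1" using b(1) by (elim oddE)
      have "even (k * (k + 1))" by simp
      then obtain l where "k * (k + 1) = 2 * l" by blast
      then have "b\<^sup>2 = 1 + 8 * l" using k by (simp add: power2_eq_square algebra_simps)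
      then show thesis by (rule that)
    qed
    then have "n * m = 8 * l - 1" using m by simp
    then have "(n * m) mod 8 = 7" by presburger
    then have "((n mod 8) * (m mod 8)) mod 8 = 7"
      by (simp add: mod_simps)
    moreover have "m mod 8 \<in> {0, 1, 2, 3, 4, 5, 6, 7}" by auto
    ultimately have m8: "m mod 8 \<in> {3, 5}"
      using less.prems by auto
    have "b\<^sup>2 \<noteq> 1" 
    proof
      assume "b\<^sup>2 = 1"
      then have "n * m = -1" using m by simp
      then have "n dvd 1" using dvd_triv_left[of n m] by simp
      then show False using n zdvd_imp_le[of n 1] by simp
    qed
    then have "b \<noteq> 1" by auto
    moreover have "b \<noteq> 2" using b by auto
    ultimately have "b \<ge> 3" using b by linarith
    then have "b\<^sup>2 \<ge> 3 * 3" unfolding power2_eq_square by (intro mult_mono) auto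
    then have "n * m > 0" using m by linarith
    then have mpos: "m > 0" using n by (intro zero_less_mult_pos[of n m]) auto
    have "b\<^sup>2 \<le> n * n" unfolding power2_eq_square using b by (intro mult_mono) auto
    then have "n * m < n * n" using m by simp
    then have "m < n" using n by simp
    moreover have "m dvd b\<^sup>2 - 2" using m by simp
    ultimately show False using less.hyps[of m b] mpos m8 n by simp
  qed
qed

lemma prime_factor_3_5_mod_8:
  fixes n :: int
  assumes "n > 0" "n mod 8 \<in> {3, 5}"
  shows "\<exists>p. prime p \<and> p dvd n \<and> p mod 8 \<in> {3, 5}"
  using assms
proof (induction "nat n" arbitrary: n rule: less_induct)
  case less
  then have "n \<ge> 3" by auto presburger+
  then obtain p where p: "prime p" "p dvd n"
    using prime_divisor_exists[of n] by (auto simp: zdvd1_eq)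
  show ?case
  proof (cases "p mod 8 \<in> {3, 5}")
    case False
    obtain m where m: "n = p * m" using p by blast
    have p2: "p \<ge> 2" using p prime_ge_2_int by blast
    then have mpos: "m > 0" using less.prems m by (simp add: zero_less_mult_iff)
    have "((p mod 8) * (m mod 8)) mod 8 \<in> {3, 5}"
      using less.prems m by (simp add: mod_simps)
    moreover have "m mod 8 \<in> {0, 1, 2, 3, 4, 5, 6, 7}" "p mod 8 \<in> {0, 1, 2, 3, 4, 5, 6, 7}"
      by auto
    ultimately have "m mod 8 \<in> {3, 5}"
      using False by auto
    moreover have "m < n" using m p2 mpos by simp
    ultimately show ?thesis
      using less.hyps[of m] mpos m by auto
  qed (use p in blast)
qed

text \<open>For an odd \<open>M\<close> the number \<open>M\<^sup>2 + 4\<close> is \<open>5\<close> modulo \<open>8\<close> and has no odd prime factor in common with \<open>M\<close>.\<close>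

lemma ex_large_prime_two_nonresidue:
  fixes B :: int
  shows "\<exists>p. prime p \<and> p > B \<and> p > 2 \<and> (\<forall>a. \<not> p dvd a\<^sup>2 - 2)"
proof -
  define M where "M = (\<Prod>i\<le>nat B. 2 * int i + 1)"
  have "odd (\<Prod>i\<in>A. 2 * int i + 1)" if "finite A" for A
    using that by induction auto
  then have "odd M" by (simp add: M_def)
  have "(M\<^sup>2 + 4) mod 8 = 5"
  proof -
    obtain k where k: "M = 2 * k + 1" using \<open>odd M\<close> by (elim oddE)
    have "even (k * (k + 1))" by simp
    then obtain l where "k * (k + 1) = 2 * l" by blast
    then have "M\<^sup>2 + 4 = 5 + 8 * l" using k by (simp add: power2_eq_square algebra_simps)
    then show ?thesis by simp
  qed
  then obtain p where p: "prime p" "p dvd M\<^sup>2 + 4" "p mod 8 \<in> {3, 5}"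
    using prime_factor_3_5_mod_8[of "M\<^sup>2 + 4"] by (auto simp: add_nonneg_pos)
  have "odd p" using p(3) by (auto; presburger)
  then have p2: "p > 2" "odd p"
    using prime_gt_1_int[OF p(1)] by (cases "p = 2"; simp)+
  have "p > B"
  proof (rule ccontr)
    assume "\<not> p > B"
    obtain k where k: "p = 2 * k + 1" using p2 by (elim oddE)
    then have "p = 2 * int (nat k) + 1" "nat k \<le> nat B"
      using p2 \<open>\<not> p > B\<close> by auto
    then have "p dvd M"
      unfolding M_def by (metis atMost_iff dvd_prodI finite_atMost)
    then have "p dvd M\<^sup>2" by (simp add: power2_eq_square)
    with p(2) have "p dvd 4"
      by (metis dvd_add_right_iff)
    then have "p dvd 2 * 2" by simp
    then have "p dvd 2" using p(1) by (metis prime_dvd_mult_iff)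
    then show False using p2 zdvd_imp_le by fastforce
  qed
  moreover have "\<not> p dvd a\<^sup>2 - 2" for a
    using p p2 by (intro two_nonresidue) auto
  ultimately show ?thesis using p p2 by blast
qed

lemma large_prime_unit:
  "\<exists>B. \<forall>p. odd_prime p \<longrightarrow> p > B \<longrightarrow> r \<in> pideal p 0 \<and> (r \<noteq> 0 \<longrightarrow> r \<notin> pideal p 1)"
proof -
  obtain a b where ab: "b > 0" "r = of_int a / of_int b"
    by (rule quotient_denom)
  have "r \<in> pideal p 0 \<and> (r \<noteq> 0 \<longrightarrow> r \<notin> pideal p 1)"
    if "odd_prime p" and large: "p > max b \<bar>a\<bar>" for p
  proof -
    interpret odd_prime p by fact
    have "\<not> p dvd b" using zdvd_not_zless[of b p] ab large by auto
    then have int: "r \<in> pideal p 0"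
      using ab by (intro pidealI[of p b _ 0 a]) auto
    moreover have "r \<notin> pideal p 1" if "r \<noteq> 0"
    proof
      assume "r \<in> pideal p 1"
      from pideal_mult0(2)[OF this pideal_of_int_0[of b]] have "of_int a \<in> pideal p 1"
        using ab by simp
      then have "p dvd a" by (simp add: of_int_in_pideal_iff)
      moreover have "a \<noteq> 0" using that ab by auto
      ultimately have "\<bar>p\<bar> \<le> \<bar>a\<bar>" by (rule dvd_imp_le_int[rotated])
      then show False using large by simp
    qed
    ultimately show ?thesis by blast
  qed
  then show ?thesis by blast
qed

lemma large_prime_units:
  assumes "finite R"
  shows "\<exists>B. \<forall>p. odd_prime p \<longrightarrow> p > B \<longrightarrow>
    (\<forall>r\<in>R. r \<in> pideal p 0 \<and> (r \<noteq> 0 \<longrightarrow> r \<notin> pideal p 1))"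
proof -
  obtain B where B: "\<And>r p. odd_prime p \<Longrightarrow> p > B r \<Longrightarrow> r \<in> pideal p 0 \<and> (r \<noteq> 0 \<longrightarrow> r \<notin> pideal p 1)"
    using large_prime_unit by metis
  have "B r \<le> Max (B ` R)" if "r \<in> R" for r
    using that assms by simp
  then show ?thesis
    using B by (intro exI[of _ "Max (B ` R)"]) (meson le_less_trans)
qed

text \<open>For \<open>c = 0\<close> a large prime keeps nonzero starting points units. For \<open>c = -1\<close>
  the identity \<open>qmap c (qmap c w) = (w\<^sup>2 - 2) * w\<^sup>2\<close> shows that an orbit of units stays so if \<open>2\<close> is
  not a square modulo \<open>p\<close>, and \<open>qmap c u = (u - 1) * (u + 1)\<close> settles the first step; the points
  \<open>0\<close>, \<open>1\<close>, \<open>-1\<close> run into the cycle of \<open>0\<close> and \<open>-1\<close>. For the other \<open>c\<close> the primes come from the critical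
  orbit.\<close>

theorem ex_good_prime:
  assumes "finite U"
  shows "\<exists>p. odd_prime p \<and> c \<in> pideal p 0 \<and> U \<subseteq> pideal p 0 \<and>
    (\<forall>u\<in>U. (\<exists>N. \<forall>n\<ge>N. (qmap c ^^ n) u \<notin> pideal p 1) \<or>
            (\<exists>N. \<forall>n\<ge>N. (qmap c ^^ n) u \<in> {0, -1}))"
proof -
  define R where "R = insert c (U \<union> (\<lambda>u. u - 1) ` U \<union> (\<lambda>u. u + 1) ` U)"
  have "finite R" using assms by (simp add: R_def)
  then obtain B where B: "\<And>p r. odd_prime p \<Longrightarrow> p > B \<Longrightarrow> r \<in> R \<Longrightarrow>
      r \<in> pideal p 0 \<and> (r \<noteq> 0 \<longrightarrow> r \<notin> pideal p 1)"
    using large_prime_units by metis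
  have good: ?thesis if p: "odd_prime p" "p > B"
    and ev: "\<And>u. u \<in> U \<Longrightarrow> (\<exists>N. \<forall>n\<ge>N. (qmap c ^^ n) u \<notin> pideal p 1) \<or>
            (\<exists>N. \<forall>n\<ge>N. (qmap c ^^ n) u \<in> {0, -1})" for p
    using B[OF p] ev p by (intro exI[of _ p]) (auto simp: R_def)
  consider "c = 0" | "c = -1" | "c \<notin> {0, -1}" by blast
  then show ?thesis
  proof cases
    case 1
    obtain q where "prime q" "q > nat (max B 2)"
      using bigger_prime by blast
    then have p: "odd_prime (int q)" "int q > B"
      by (auto simp: odd_prime_def)
    interpret odd_prime "int q" by fact
    show ?thesis
    proof (rule good[OF p])
      fix u assume u: "u \<in> U"
      show "(\<exists>N. \<forall>n\<ge>N. (qmap c ^^ n) u \<notin> pideal (int q) 1) \<or>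
            (\<exists>N. \<forall>n\<ge>N. (qmap c ^^ n) u \<in> {0, -1})"
      proof (cases "u = 0")
        case True
        have "(qmap c ^^ n) u = 0" for n
          by (induction n) (simp_all add: qmap_def 1 True)
        then show ?thesis by simp
      next
        case False
        then have unit: "u \<in> pideal (int q) 0" "u \<notin> pideal (int q) 1"
          using B[OF p, of u] u by (auto simp: R_def)
        have "(qmap c ^^ n) u \<in> pideal (int q) 0 \<and> (qmap c ^^ n) u \<notin> pideal (int q) 1" for n
        proof (induction n)
          case (Suc n)
          then show ?case
            using pideal_mult_unit pideal_mult0
            by (simp add: qmap_def 1 power2_eq_square)
        qed (use unit in simp)
        then show ?thesis by blast
      qed
    qed
  next
    case 2
    obtain p where p: "prime p" "p > B" "p > 2" and nonres: "\<And>a. \<not> p dvd a\<^sup>2 - 2"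
      using ex_large_prime_two_nonresidue by blast
    interpret odd_prime p by standard (use p in auto)
    have p': "odd_prime p" by (rule odd_prime_axioms)
    have q: "qmap c t = (t - 1) * (t + 1)" for t
      by (simp add: qmap_def 2 power2_eq_square algebra_simps)
    \<comment> \<open>The residue field of the localization is that of the integers, so \<open>2\<close> is no square there either.\<close>
    have sq2: "w\<^sup>2 - 2 \<notin> pideal p 1" if w: "w \<in> pideal p 0" for w
    proof
      assume "w\<^sup>2 - 2 \<in> pideal p 1"
      obtain a where a: "w - of_int a \<in> pideal p 1"
        using pideal_residue[OF w] by blast
      have "(w - of_int a) * (w + of_int a) \<in> pideal p 1"
        by (intro pideal_mult0(2)[OF a] pideal_add w) simp
      from pideal_diff[OF \<open>w\<^sup>2 - 2 \<in> pideal p 1\<close> this] have "of_int (a\<^sup>2 - 2) \<in> pideal p 1"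
        by (simp add: power2_eq_square algebra_simps)
      then show False using nonres by (simp add: of_int_in_pideal_iff del: of_int_diff)
    qed
    show ?thesis
    proof (rule good[OF p' p(2)])
      fix u assume u: "u \<in> U"
      show "(\<exists>N. \<forall>n\<ge>N. (qmap c ^^ n) u \<notin> pideal p 1) \<or>
            (\<exists>N. \<forall>n\<ge>N. (qmap c ^^ n) u \<in> {0, -1})"
      proof (cases "u \<in> {0, 1, -1}")
        case True
        have "(qmap c ^^ Suc n) u \<in> {0, -1}" for n
          by (induction n) (use True in \<open>auto simp: q\<close>)
        then have "\<forall>n\<ge>1. (qmap c ^^ n) u \<in> {0, -1}"
          by (metis One_nat_def Suc_le_D)
        then show ?thesis by blast
      next
        case False
        have units: "u \<in> pideal p 0" "u \<notin> pideal p 1" "u - 1 \<in> pideal p 0" "u - 1 \<notin> pideal p 1"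
          "u + 1 \<in> pideal p 0" "u + 1 \<notin> pideal p 1"
          using B[OF p' p(2), of u] B[OF p' p(2), of "u - 1"] B[OF p' p(2), of "u + 1"] u False
          by (auto simp: R_def eq_neg_iff_add_eq_0)
        have cint: "c \<in> pideal p 0"
          using B[OF p' p(2), of c] by (simp add: R_def)
        have two: "qmap c (qmap c w) = (w\<^sup>2 - 2) * (w * w)" for w
          by (simp add: qmap_def 2 power2_eq_square algebra_simps)
        have "(qmap c ^^ n) u \<notin> pideal p 1 \<and> (qmap c ^^ Suc n) u \<notin> pideal p 1" for n
        proof (induction n)
          case 0
          then show ?case
            using units pideal_mult_unit[OF units(3-6)] by (simp add: q)
        next
          case (Suc n)
          let ?w = "(qmap c ^^ n) u"
          have w: "?w \<in> pideal p 0" by (rule qmap_pideal[OF cint units(1)])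
          have w2: "?w\<^sup>2 - 2 \<in> pideal p 0"
            using pideal_diff[OF pideal_power[OF w, of 2] pideal_of_int_0[of 2]] by simp
          have "?w * ?w \<in> pideal p 0" "?w * ?w \<notin> pideal p 1"
            using pideal_mult0(1)[OF w w] pideal_mult_unit[OF w _ w] Suc by blast+
          then have "qmap c (qmap c ?w) \<notin> pideal p 1"
            unfolding two by (rule pideal_mult_unit[OF w2 sq2[OF w]])
          with Suc show ?case by simp
        qed
        then show ?thesis by blast
      qed
    qed
  next
    case 3
    obtain a v where av: "quotient_of c = (a, v)" by (cases "quotient_of c")
    have v: "v > 0" and cop: "coprime a v" and c: "c = of_int a / of_int v"
      using av quotient_of_denom_pos quotient_of_coprime quotient_of_div by auto
    obtain p n where p: "prime p" "p > B" "p > 2" "\<not> p dvd v" "p dvd antifix a v n"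
      using infinitely_many_antifix_primes[OF v cop] 3 c by blast
    interpret odd_prime p by standard (use p in auto)
    have p': "odd_prime p" by (rule odd_prime_axioms)
    have cint: "c \<in> pideal p 0"
      using B[OF p' p(2), of c] by (simp add: R_def)
    have "(qmap c ^^ n) 0 \<notin> pideal p 1" if "n > 0" for n
      using critical_orbit_unit[OF cint _ that] dvd_antifix_imp[OF v p(4,5)] c by blast
    then show ?thesis
      using orbit_eventually_unit[OF cint] B[OF p' p(2)]
      by (intro good[OF p' p(2)]) (auto simp: R_def)
  qed
qed

section \<open>Projective coordinates and the return set\<close>

lemma proj1_coords_ex:
  fixes z :: "'a::field proj1"
  shows "\<exists>a b. proj1_coords z a b"
proof transfer
  fix z :: "'a \<times> 'a"
  assume "proj1_rel z z"
  then show "\<exists>a b. proj1_rel z (a, b)" by (metis surj_pair)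
qed

lemma proj1_coords_nonzero: "proj1_coords z a b \<Longrightarrow> a \<noteq> 0 \<or> b \<noteq> 0"
  by transfer (auto simp: proj1_rel_def)

lemma proj1_coords_proportional:
  fixes z :: "'a::field proj1"
  shows "proj1_coords z a b \<Longrightarrow> proj1_coords z a' b' \<Longrightarrow> \<exists>c. c \<noteq> 0 \<and> a' = c * a \<and> b' = c * b"
proof transfer
  fix z :: "'a \<times> 'a" and a b a' b'
  assume "proj1_rel z (a, b)" "proj1_rel z (a', b')"
  then have "proj1_rel (a, b) (a', b')"
    using proj1_rel_sym proj1_rel_trans by blast
  then show "\<exists>c. c \<noteq> 0 \<and> a' = c * a \<and> b' = c * b"
    by (auto simp: proj1_rel_def)
qed

lemma proj1_coords_scale:
  fixes z :: "'a::field proj1"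
  shows "proj1_coords z a b \<Longrightarrow> c \<noteq> 0 \<Longrightarrow> proj1_coords z (c * a) (c * b)"
proof transfer
  fix z :: "'a \<times> 'a" and a b c :: 'a
  assume "proj1_rel z (a, b)" "c \<noteq> 0"
  then have "proj1_rel (a, b) (c * a, c * b)"
    by (auto simp: proj1_rel_def)
  with \<open>proj1_rel z (a, b)\<close> show "proj1_rel z (c * a, c * b)"
    by (rule proj1_rel_trans)
qed

lemma proj1_coords_of_rat:
  "proj1_coords z a b \<Longrightarrow> proj1_coords (proj1_of_rat z :: 'k::field_char_0 proj1) (of_rat a) (of_rat b)"
proof transfer
  fix z :: "rat \<times> rat" and a b
  assume "proj1_rel z (a, b)"
  then obtain c where "z \<noteq> (0, 0)" "(a, b) \<noteq> (0, 0)" "c \<noteq> 0" "a = c * fst z" "b = c * snd z"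
    by (auto simp: proj1_rel_def)
  then show "proj1_rel (case z of (a, b) \<Rightarrow> (of_rat a, of_rat b)) (of_rat a :: 'k, of_rat b)"
    unfolding proj1_rel_def
    by (intro conjI exI[of _ "of_rat c"]) (auto simp: of_rat_mult split: prod.splits)
qed

lemma proj1_coords_poly:
  fixes z :: "'a::field proj1"
  shows "proj1_coords z a b \<Longrightarrow> proj1_coords (proj1_poly f z) (homogenize f a b) (b ^ degree f)"
proof transfer
  fix f :: "'a poly" and z :: "'a \<times> 'a" and a b
  assume "proj1_rel z (a, b)"
  then obtain c where z: "z \<noteq> (0, 0)" "(a, b) \<noteq> (0, 0)" "c \<noteq> 0" "a = c * fst z" "b = c * snd z"
    by (auto simp: proj1_rel_def)
  have nz: "(homogenize f s t, t ^ degree f) \<noteq> (0, 0)" if "(s, t) \<noteq> (0, 0)" for s t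
    using that by (cases "t = 0") (auto simp: homogenize_at_infinity)
  show "proj1_rel (case z of (a, b) \<Rightarrow> (homogenize f a b, b ^ degree f))
      (homogenize f a b, b ^ degree f)"
    unfolding proj1_rel_def
  proof (intro conjI exI[of _ "c ^ degree f"])
    show "(case z of (a, b) \<Rightarrow> (homogenize f a b, b ^ degree f)) \<noteq> (0, 0)"
      using nz[of "fst z" "snd z"] z(1) by (cases z) simp
    show "(homogenize f a b, b ^ degree f) \<noteq> (0, 0)"
      using nz z(2) by blast
  qed (use z in \<open>auto simp: homogenize_scale power_mult_distrib split: prod.splits\<close>)
qed

lemma proj1_cases:
  obtains (affine) t where "proj1_coords z t 1" | (infinity) "proj1_coords z 1 0"
proof -
  obtain a b where ab: "proj1_coords z a b" using proj1_coords_ex by blast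
  show thesis
  proof (cases "b = 0")
    case True
    then have "a \<noteq> 0" using proj1_coords_nonzero[OF ab] by simp
    then show ?thesis
      using proj1_coords_scale[OF ab, of "inverse a"] True infinity by simp
  next
    case False
    then show ?thesis
      using proj1_coords_scale[OF ab, of "inverse b"] affine by simp
  qed
qed

lemma homogenize_affine: "homogenize f t 1 = poly f t"
  by (simp add: homogenize_def poly_altdef)

lemma proj1_poly_iter_affine:
  "proj1_coords z t 1 \<Longrightarrow> proj1_coords ((proj1_poly f ^^ m) z) ((poly f ^^ m) t) 1"
proof (induction m)
  case (Suc m)
  from proj1_coords_poly[OF Suc.IH[OF Suc.prems], of f] show ?case
    by (simp add: homogenize_affine)
qed simp

lemma proj1_poly_iter_infinity:
  assumes "proj1_coords z 1 0" "degree f > 0"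
  shows "proj1_coords ((proj1_poly f ^^ m) z) 1 0"
proof (induction m)
  case (Suc m)
  have "lead_coeff f \<noteq> 0" using assms(2) by auto
  then show ?case
    using proj1_coords_scale[OF proj1_coords_poly[OF Suc, of f], of "inverse (lead_coeff f)"] assms(2)
    by (simp add: homogenize_at_infinity zero_power)
qed (use assms in simp)

lemma diag_action_iter: "(diag_action f ^^ m) x $ i = (proj1_poly f ^^ m) (x $ i)"
  by (induction m) (simp_all add: diag_action_def)

lemma eval_rat_mpoly_case_sum:
  fixes P :: "('n::finite + 'n) rat_mpoly"
  shows "eval_rat_mpoly P (case_sum a b) =
    (\<Sum>m\<in>Poly_Mapping.keys P. of_rat (Poly_Mapping.lookup P m) *
      (\<Prod>i\<in>UNIV. a i ^ Poly_Mapping.lookup m (Inl i) * b i ^ Poly_Mapping.lookup m (Inr i)))"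
  unfolding eval_rat_mpoly_def
proof (intro sum.cong refl arg_cong2[where f = "(*)"])
  fix m :: "('n + 'n) \<Rightarrow>\<^sub>0 nat"
  let ?g = "\<lambda>v. case_sum a b v ^ Poly_Mapping.lookup m v"
  have "prod ?g (Poly_Mapping.keys m) = prod ?g UNIV"
    by (rule prod.mono_neutral_left) (auto simp: in_keys_iff)
  also have "\<dots> = prod ?g (UNIV <+> UNIV)"
    by (simp only: UNIV_Plus_UNIV)
  also have "\<dots> = (\<Prod>i\<in>UNIV. ?g (Inl i)) * (\<Prod>i\<in>UNIV. ?g (Inr i))"
    by (subst prod.Plus) simp_all
  finally show "prod ?g (Poly_Mapping.keys m) =
      (\<Prod>i\<in>UNIV. a i ^ Poly_Mapping.lookup m (Inl i) * b i ^ Poly_Mapping.lookup m (Inr i))"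
    by (simp add: prod.distrib)
qed

text \<open>Rescaling the homogeneous coordinates multiplies the value by a product of powers of the factors. This makes
  vanishing independent of the choice of coordinates.\<close>

lemma eval_multihomogeneous_scale:
  fixes P :: "('n::finite + 'n) rat_mpoly"
  assumes "multihomogeneous P"
  shows "\<exists>d. eval_rat_mpoly P (case_sum (\<lambda>i. c i * a i) (\<lambda>i. c i * b i)) =
    (\<Prod>i\<in>UNIV. c i ^ d i) * eval_rat_mpoly P (case_sum a b)"
proof -
  obtain d where d: "\<And>m i. m \<in> Poly_Mapping.keys P \<Longrightarrow>
      Poly_Mapping.lookup m (Inl i) + Poly_Mapping.lookup m (Inr i) = d i"
    using assms unfolding multihomogeneous_def by blast
  have "eval_rat_mpoly P (case_sum (\<lambda>i. c i * a i) (\<lambda>i. c i * b i)) =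
    (\<Prod>i\<in>UNIV. c i ^ d i) * eval_rat_mpoly P (case_sum a b)"
    unfolding eval_rat_mpoly_case_sum sum_distrib_left
  proof (intro sum.cong refl)
    fix m assume m: "m \<in> Poly_Mapping.keys P"
    have eq: "(c i * a i) ^ Poly_Mapping.lookup m (Inl i) * (c i * b i) ^ Poly_Mapping.lookup m (Inr i) =
      c i ^ d i * (a i ^ Poly_Mapping.lookup m (Inl i) * b i ^ Poly_Mapping.lookup m (Inr i))" for i
      by (simp add: power_mult_distrib d[OF m, of i, symmetric] power_add)
    then show "of_rat (Poly_Mapping.lookup P m) * (\<Prod>i\<in>UNIV. (c i * a i) ^ Poly_Mapping.lookup m (Inl i) *
        (c i * b i) ^ Poly_Mapping.lookup m (Inr i)) =
      (\<Prod>i\<in>UNIV. c i ^ d i) * (of_rat (Poly_Mapping.lookup P m) *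
        (\<Prod>i\<in>UNIV. a i ^ Poly_Mapping.lookup m (Inl i) * b i ^ Poly_Mapping.lookup m (Inr i)))"
      unfolding eq prod.distrib by (simp only: ac_simps)
  qed
  then show ?thesis by blast
qed

lemma eval_rat_mpoly_of_rat:
  fixes P :: "('n::finite + 'n) rat_mpoly"
  shows "eval_rat_mpoly P (case_sum (\<lambda>i. of_rat (a i)) (\<lambda>i. of_rat (b i))) =
    of_rat (eval_rat_mpoly P (case_sum a b) :: rat)"
  by (simp add: eval_rat_mpoly_case_sum of_rat_sum of_rat_mult of_rat_prod of_rat_power)

text \<open>A single choice of rational coordinates decides vanishing at a rational point of the complex variety.\<close>

lemma vanishes_at_rational_point_iff:
  fixes P :: "('n::finite + 'n) rat_mpoly" and y :: "rat proj1 ^ 'n"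
  assumes P: "multihomogeneous P" and y: "\<And>i. proj1_coords (y $ i) (a i) (b i)"
  shows "vanishes_at P (\<chi> i. (proj1_of_rat (y $ i) :: 'k::field_char_0 proj1)) \<longleftrightarrow>
    eval_rat_mpoly P (case_sum a b) = (0 :: rat)"
proof
  let ?z = "\<chi> i. (proj1_of_rat (y $ i) :: 'k proj1)"
  have coords: "proj1_coords (?z $ i) (of_rat (a i)) (of_rat (b i))" for i
    using proj1_coords_of_rat[OF y] by simp
  show "eval_rat_mpoly P (case_sum a b) = (0 :: rat)" if "vanishes_at P ?z"
    using that coords eval_rat_mpoly_of_rat[of P a b, where 'a = 'k]
    unfolding vanishes_at_def by fastforce
  assume 0: "eval_rat_mpoly P (case_sum a b) = (0 :: rat)"
  show "vanishes_at P ?z"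
    unfolding vanishes_at_def
  proof (intro allI impI)
    fix a' b' :: "'n \<Rightarrow> 'k"
    assume "\<forall>i. proj1_coords (?z $ i) (a' i) (b' i)"
    then have "\<exists>c. a' i = c * of_rat (a i) \<and> b' i = c * of_rat (b i)" for i
      using proj1_coords_proportional[OF coords] by blast
    then obtain c where "\<And>i. a' i = c i * of_rat (a i)" "\<And>i. b' i = c i * of_rat (b i)"
      by metis
    then have "a' = (\<lambda>i. c i * of_rat (a i))" "b' = (\<lambda>i. c i * of_rat (b i))"
      by auto
    then show "eval_rat_mpoly P (case_sum a' b') = 0"
      using eval_multihomogeneous_scale[OF P, of c "\<lambda>i. of_rat (a i)" "\<lambda>i. of_rat (b i)"] 0
      by (auto simp: eval_rat_mpoly_of_rat)
  qed
qed

lemma (in odd_prime) rapid_diffs_eval: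
  fixes P :: "('n::finite + 'n) rat_mpoly"
  assumes "\<And>i. rapid_diffs p (\<lambda>n. a n i)" "\<And>i. rapid_diffs p (\<lambda>n. b n i)"
  shows "rapid_diffs p (\<lambda>n. eval_rat_mpoly P (case_sum (a n) (b n)))"
  unfolding eval_rat_mpoly_case_sum
  by (intro rapid_diffs_sum rapid_diffs_mult[OF rapid_diffs_const] rapid_diffs_prod
      rapid_diffs_mult[OF rapid_diffs_power rapid_diffs_power] assms)

text \<open>Completing the square: with \<open>r\<close> the leading coefficient and \<open>s\<close> half the linear one, \<open>r * t + s\<close> conjugates
  \<open>f\<close> to \<open>t\<^sup>2 + c\<close>.\<close>

lemma quadratic_conjugate:
  fixes f :: "rat poly"
  assumes "degree f = 2"
  shows "\<exists>r s c. r \<noteq> 0 \<and> (\<forall>m t. (poly f ^^ m) t = ((qmap c ^^ m) (r * t + s) - s) / r)"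
proof -
  define r s where "r = coeff f 2" and "s = coeff f 1 / 2"
  define c where "c = r * coeff f 0 + s - s\<^sup>2"
  have r: "r \<noteq> 0" using assms leading_coeff_0_iff[of f] by (auto simp: r_def)
  have f: "poly f t = r * t\<^sup>2 + 2 * s * t + coeff f 0" for t
    unfolding poly_altdef assms r_def s_def
    by (simp add: numeral_2_eq_2 power2_eq_square algebra_simps)
  have "r * (poly f ^^ m) t + s = (qmap c ^^ m) (r * t + s)" for m t
  proof (induction m)
    case (Suc m)
    have "r * poly f u + s = qmap c (r * u + s)" for u
      by (simp add: f qmap_def c_def power2_eq_square algebra_simps)
    with Suc show ?case by simp
  qed simp
  then have "(poly f ^^ m) t = ((qmap c ^^ m) (r * t + s) - s) / r" for m t
    using r by (metis add_diff_cancel_right' nonzero_mult_div_cancel_left)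
  with r show ?thesis by blast
qed

text \<open>Step \<open>0\<close> gives the progressions with one element, which account for the times before \<open>N\<close> and for the
  residue classes met finitely often.\<close>

lemma eventually_periodic_set_is_union_of_progressions:
  fixes R :: "nat set"
  assumes M: "M > 0"
    and dichotomy: "\<And>l. l \<ge> N \<Longrightarrow> finite {n. l + M * n \<in> R} \<or> (\<forall>n. l + M * n \<in> R)"
  shows "\<exists>A :: (nat \<times> nat) set. finite A \<and> R = (\<Union>(k, l)\<in>A. {n * k + l | n. True})"
proof -
  \<comment> \<open>The classes in which the set holds every time, against the finitely many remaining members.\<close>
  define full where "full = {l \<in> {N..<N + M}. \<forall>n. l + M * n \<in> R}"
  define rest where "rest = R \<inter> {..<N} \<union> (\<Union>l\<in>{N..<N + M} - full. (\<lambda>n. l + M * n) ` {n. l + M * n \<in> R})"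
  have "finite rest"
    unfolding rest_def
  proof (intro finite_UnI finite_UN_I finite_imageI)
    fix l assume "l \<in> {N..<N + M} - full"
    then show "finite {n. l + M * n \<in> R}"
      using dichotomy[of l] by (auto simp: full_def)
  qed auto
  have "R = rest \<union> (\<Union>l\<in>full. {n * M + l | n. True})"
  proof (intro equalityI subsetI)
    fix m assume m: "m \<in> R"
    show "m \<in> rest \<union> (\<Union>l\<in>full. {n * M + l | n. True})"
    proof (cases "m < N")
      case True
      with m show ?thesis by (simp add: rest_def)
    next
      case False
      define l n where "l = N + (m - N) mod M" and "n = (m - N) div M"
      have lm: "m = l + M * n" "l \<in> {N..<N + M}"
        using False M by (simp_all add: l_def n_def)
      show ?thesis
      proof (cases "l \<in> full")
        case True
        moreover have "m = n * M + l" using lm(1) by simp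
        ultimately show ?thesis by blast
      next
        case False
        then show ?thesis using lm m by (auto simp: rest_def)
      qed
    qed
  next
    fix m assume "m \<in> rest \<union> (\<Union>l\<in>full. {n * M + l | n. True})"
    then show "m \<in> R"
      by (auto simp: rest_def full_def algebra_simps)
  qed
  also have "\<dots> = (\<Union>(k, l)\<in>Pair 0 ` rest \<union> Pair M ` full. {n * k + l | n. True})"
    by auto
  finally show ?thesis
    using \<open>finite rest\<close> by (intro exI[of _ "Pair 0 ` rest \<union> Pair M ` full"]) (auto simp: full_def)
qed

text \<open>Within one residue class of times, a single equation that fails somewhere already restricts the returns to
  finitely many, whatever the number of equations. A coordinate at infinity stays there and enters the
  equations through the constant pair \<open>(1, 0)\<close>.\<close>

theorem theorem1p6:
  fixes V :: "(complex proj1 ^ 'n::finite) set"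
    and f :: "rat poly"
    and x :: "rat proj1 ^ 'n"
  assumes "subvariety_over_rat V"
    and "degree f = 2"
  shows "\<exists>A :: (nat \<times> nat) set. finite A \<and>
           rational_points V \<inter> forward_orbit (diag_action f) x =
             (\<Union>(k, l)\<in>A. {(diag_action f ^^ (n * k + l)) x | n. True})"
proof -
  let ?F = "diag_action f"
  obtain S where S: "\<And>P. P \<in> S \<Longrightarrow> multihomogeneous P" and V: "V = {z. \<forall>P\<in>S. vanishes_at P z}"
    using assms(1) unfolding subvariety_over_rat_def by blast
  obtain r s c where r: "r \<noteq> 0"
    and conj: "\<And>m t. (poly f ^^ m) t = ((qmap c ^^ m) (r * t + s) - s) / r"
    using quadratic_conjugate[OF assms(2)] by blast
  have "\<exists>t. proj1_coords (x $ i) t 1 \<or> proj1_coords (x $ i) 1 0" for i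
    by (cases "x $ i" rule: proj1_cases) auto
  then obtain t where t: "\<And>i. proj1_coords (x $ i) (t i) 1 \<or> proj1_coords (x $ i) 1 0"
    by metis
  define aff where "aff i \<longleftrightarrow> proj1_coords (x $ i) (t i) 1" for i
  define a where "a m i = (if aff i then (poly f ^^ m) (t i) else 1)" for m i
  define b where "b i = (if aff i then 1 else 0 :: rat)" for i
  have coords: "proj1_coords ((?F ^^ m) x $ i) (a m i) (b i)" for m i
    using t[of i] proj1_poly_iter_affine proj1_poly_iter_infinity[of "x $ i" f m] assms(2)
    by (auto simp: diag_action_iter a_def b_def aff_def)
  define U where "U = range (\<lambda>i. r * t i + s)"
  have "finite U" by (simp add: U_def)
  then obtain p where p: "odd_prime p" "c \<in> pideal p 0" "U \<subseteq> pideal p 0"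
    and ev: "\<And>u. u \<in> U \<Longrightarrow> (\<exists>N. \<forall>n\<ge>N. (qmap c ^^ n) u \<notin> pideal p 1) \<or>
            (\<exists>N. \<forall>n\<ge>N. (qmap c ^^ n) u \<in> {0, -1})"
    using ex_good_prime by meson
  interpret odd_prime p by fact
  obtain M N where M: "M > 0" and rapid: "\<And>l u. l \<ge> N \<Longrightarrow> u \<in> U \<Longrightarrow>
      rapid_diffs p (\<lambda>n. (qmap c ^^ (l + M * n)) u)"
    using orbits_rapid_diffs[OF p(2) \<open>finite U\<close> p(3) ev] by blast
  define R where "R = {m. (?F ^^ m) x \<in> rational_points V}"
  have R: "m \<in> R \<longleftrightarrow> (\<forall>P\<in>S. eval_rat_mpoly P (case_sum (a m) b) = (0 :: rat))" for m
    using vanishes_at_rational_point_iff[OF S coords]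
    by (auto simp: R_def rational_points_def V)
  have "finite {n. l + M * n \<in> R} \<or> (\<forall>n. l + M * n \<in> R)" if l: "l \<ge> N" for l
  proof (rule disjCI)
    assume "\<not> (\<forall>n. l + M * n \<in> R)"
    then obtain P n where P: "P \<in> S" "eval_rat_mpoly P (case_sum (a (l + M * n)) b) \<noteq> (0 :: rat)"
      by (auto simp: R)
    have "rapid_diffs p (\<lambda>n. a (l + M * n) i)" for i
    proof (cases "aff i")
      case True
      have "r * t i + s \<in> U" unfolding U_def by (rule rangeI)
      from rapid_diffs_mult[OF rapid_diffs_add[OF rapid[OF l this] rapid_diffs_const[of "-s"]]
          rapid_diffs_const[of "1 / r"]]
      show ?thesis using True by (simp add: a_def conj)
    qed (simp add: a_def rapid_diffs_const)
    then have "rapid_diffs p (\<lambda>n. eval_rat_mpoly P (case_sum (a (l + M * n)) b))"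
      by (intro rapid_diffs_eval rapid_diffs_const)
    from rapid_diffs_infinitely_many_zeros[OF this] P(2)
    have "finite {n. eval_rat_mpoly P (case_sum (a (l + M * n)) b) = (0 :: rat)}"
      by blast
    then show "finite {n. l + M * n \<in> R}"
      by (rule rev_finite_subset) (use P in \<open>auto simp: R\<close>)
  qed
  then have "\<exists>A :: (nat \<times> nat) set. finite A \<and> R = (\<Union>(k, l)\<in>A. {n * k + l | n. True})"
    by (rule eventually_periodic_set_is_union_of_progressions[OF M])
  then obtain A :: "(nat \<times> nat) set"
    where A: "finite A" "R = (\<Union>(k, l)\<in>A. {n * k + l | n. True})"
    by (elim exE conjE)
  have "rational_points V \<inter> forward_orbit ?F x = (\<lambda>m. (?F ^^ m) x) ` R"
    by (auto simp: forward_orbit_def R_def)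
  also have "\<dots> = (\<Union>(k, l)\<in>A. {(?F ^^ (n * k + l)) x | n. True})"
    unfolding A(2) image_UN by (rule SUP_cong) auto
  finally show ?thesis using A(1) by blast
qed

end
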